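(* Let $\mathrm{RWRTP}(\Omega,\lambda,T,\mu)$ be an irreducible random walk with random transition probabilities with a finite first moment on a finitely generated nilpotent group $G$. Then for any $g\in G$ and $\lambda$-a.e. $\omega\in\Omega$ $$\|g\mu^\omega_{0,n}-\mu^\omega_{0,n}\|\xrightarrow[n\to\infty]{}0,$$ i.e., for a.e. $\omega$ the sequence $\mu^\omega_{0,n}$ strongly converges to left invariance on $G$.
   Context: $(\Omega,\lambda)$ is a Lebesgue probability space with an invertible ergodic measure preserving transformation $T$, and $\omega\mapsto\mu^\omega$ is a measurable map from $\Omega$ to the probability measures on $G$. The associated $\mathrm{RWRTP}(\Omega,\lambda,T,\mu)$ is the family, parameterized by $\omega\in\Omega$, of Markov chains $\mathrm{RWTDI}(\omega)$ on $G$ with transition probabilities $\mathrm{Prob}(x_{n+1}=gh\mid x_n=g)=\mu^{T^n\omega}(h)$ at time $n$. $\mu^\omega_{0,n}=\mu^\omega\mu^{T\omega}\cdots\mu^{T^n\omega}$ (convolution), $g\theta$ is the left translate of a measure $\theta$ by $g$, and $\|\cdot\|$ is the total variation norm. Finite first moment: $\int_\Omega\sum_g|g|\,\mu^\omega(g)\,d\lambda(\omega)<\infty$, where $|g|$ is the word length with respect to a finite generating set of $G$. Irreducibility: for $\lambda$-a.e. $\omega$ the chain $\mathrm{RWTDI}(\omega)$ is irreducible, which means that the subgroup of $G$ generated by all $g\in G$ such that the measures $\mu^\omega_{0,n}$ and $g\mu^\omega_{0,n}$ are not mutually singular for some $n$ is the whole of $G$. *)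

theory Defs
  imports
    "HOL-Algebra.Generated_Groups"
    "HOL-Probability.Probability"
begin

subsection \<open>Nilpotent groups and word length\<close>

primrec lower_central :: "('g, 'b) monoid_scheme \<Rightarrow> nat \<Rightarrow> 'g set" where
  "lower_central G 0 = carrier G"
| "lower_central G (Suc n) =
     generate G (\<Union>x \<in> lower_central G n. \<Union>y \<in> carrier G.
       {x \<otimes>\<^bsub>G\<^esub> y \<otimes>\<^bsub>G\<^esub> inv\<^bsub>G\<^esub> x \<otimes>\<^bsub>G\<^esub> inv\<^bsub>G\<^esub> y})"

definition nilpotent_group :: "('g, 'b) monoid_scheme \<Rightarrow> bool" where
  "nilpotent_group G \<longleftrightarrow> group G \<and> (\<exists>n. lower_central G n = {\<one>\<^bsub>G\<^esub>})"

definition word_length :: "('g, 'b) monoid_scheme \<Rightarrow> 'g set \<Rightarrow> 'g \<Rightarrow> nat" where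
  "word_length G S g = (LEAST n. \<exists>xs. length xs = n \<and> set xs \<subseteq> S \<union> (\<lambda>s. inv\<^bsub>G\<^esub> s) ` S \<and>
     g = foldr (\<lambda>x y. x \<otimes>\<^bsub>G\<^esub> y) xs \<one>\<^bsub>G\<^esub>)"


subsection \<open>Probability measures on a discrete group\<close>

text \<open>Probability measures on the (countable, discrete) group are probability mass functions
  supported by the carrier.\<close>

definition convolution_pmf :: "('g, 'b) monoid_scheme \<Rightarrow> 'g pmf \<Rightarrow> 'g pmf \<Rightarrow> 'g pmf" where
  "convolution_pmf G p q = map_pmf (\<lambda>(x, y). x \<otimes>\<^bsub>G\<^esub> y) (pair_pmf p q)"

definition translate_pmf :: "('g, 'b) monoid_scheme \<Rightarrow> 'g \<Rightarrow> 'g pmf \<Rightarrow> 'g pmf" where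
  "translate_pmf G g p = map_pmf (\<lambda>x. g \<otimes>\<^bsub>G\<^esub> x) p"

definition mutually_singular :: "'a measure \<Rightarrow> 'a measure \<Rightarrow> bool" where
  "mutually_singular M N \<longleftrightarrow> sets M = sets N \<and>
     (\<exists>A \<in> sets M. emeasure M A = 0 \<and> emeasure N (space N - A) = 0)"

text \<open>A signed measure on a discrete set is identified with the function of its point masses; its
  total variation norm, the total mass of its variation \<open>|\<nu>|\<close>, is then the \<open>l\<^sup>1\<close>-norm
  (no factor \<open>1/2\<close>).  The family is summable whenever the
  argument is a difference of two probability mass functions.\<close>

definition tv_norm :: "('a \<Rightarrow> real) \<Rightarrow> real" where
  "tv_norm \<nu> = (\<Sum>\<^sub>\<infinity>x. \<bar>\<nu> x\<bar>)"

definition strongly_converges_to_left_invariance ::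
  "('g, 'b) monoid_scheme \<Rightarrow> (nat \<Rightarrow> 'g pmf) \<Rightarrow> bool" where
  "strongly_converges_to_left_invariance G \<theta> \<longleftrightarrow>
     (\<forall>g \<in> carrier G.
        (\<lambda>n. tv_norm (\<lambda>x. pmf (translate_pmf G g (\<theta> n)) x - pmf (\<theta> n) x)) \<longlonglongrightarrow> 0)"


subsection \<open>Lebesgue spaces and their transformations\<close>

definition mod0_inverse :: "'a measure \<Rightarrow> 'b measure \<Rightarrow> ('a \<Rightarrow> 'b) \<Rightarrow> ('b \<Rightarrow> 'a) \<Rightarrow> bool" where
  "mod0_inverse M N f g \<longleftrightarrow> f \<in> measurable M N \<and> g \<in> measurable N M \<and>
     (AE x in M. g (f x) = x) \<and> (AE y in N. f (g y) = y)"

definition isomorphic_mod0 :: "'a measure \<Rightarrow> 'b measure \<Rightarrow> bool" where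
  "isomorphic_mod0 M N \<longleftrightarrow>
     (\<exists>f g. mod0_inverse M N f g \<and> distr M N f = N \<and> distr N M g = M)"

text \<open>Rokhlin's Lebesgue spaces: isomorphic mod 0 to an interval with Lebesgue measure together with
  at most countably many atoms (placed here at \<open>-1, -2, \<dots>\<close>, the \<open>n\<close>-th one having the possibly
  vanishing mass \<open>c n\<close>).  The condition is put on the completion, so that both complete spaces and
  standard Borel probability spaces qualify.\<close>

definition interval_with_atoms :: "real \<Rightarrow> (nat \<Rightarrow> ennreal) \<Rightarrow> real measure \<Rightarrow> bool" where
  "interval_with_atoms s c N \<longleftrightarrow> sets N = sets borel \<and>
     (\<forall>A \<in> sets borel. emeasure N A =
        emeasure lborel (A \<inter> {0..<s}) + (\<Sum>n. c n * indicator A (- 1 - real n)))"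

definition lebesgue_prob_space :: "'a measure \<Rightarrow> bool" where
  "lebesgue_prob_space M \<longleftrightarrow> prob_space M \<and>
     (\<exists>s c N. interval_with_atoms s c N \<and> isomorphic_mod0 (completion M) (completion N))"

text \<open>Invertibility is understood mod 0, as usual for Lebesgue spaces; a bijection of the space
  which is measurable together with its inverse is a special case.\<close>

definition invertible_mpt :: "'a measure \<Rightarrow> ('a \<Rightarrow> 'a) \<Rightarrow> bool" where
  "invertible_mpt M T \<longleftrightarrow> distr M M T = M \<and> (\<exists>T'. mod0_inverse M M T T')"

definition ergodic_transformation :: "'a measure \<Rightarrow> ('a \<Rightarrow> 'a) \<Rightarrow> bool" where
  "ergodic_transformation M T \<longleftrightarrow>
     (\<forall>A \<in> sets M. T -` A \<inter> space M = A \<longrightarrow> emeasure M A = 0 \<or> emeasure M (space M - A) = 0)"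


subsection \<open>Random walks with random transition probabilities\<close>

text \<open>The space \<open>(\<Omega>, \<lambda>)\<close> is the measure \<open>M\<close>.\<close>

definition rwrtp :: "('g, 'b) monoid_scheme \<Rightarrow> 'w measure \<Rightarrow> ('w \<Rightarrow> 'w) \<Rightarrow> ('w \<Rightarrow> 'g pmf) \<Rightarrow> bool" where
  "rwrtp G M T \<mu> \<longleftrightarrow> group G \<and> lebesgue_prob_space M \<and>
     invertible_mpt M T \<and> ergodic_transformation M T \<and>
     (\<forall>\<omega> \<in> space M. set_pmf (\<mu> \<omega>) \<subseteq> carrier G) \<and>
     (\<lambda>\<omega>. measure_pmf (\<mu> \<omega>)) \<in> measurable M (prob_algebra (count_space UNIV))"

text \<open>The law of \<open>x\<^bsub>n+1\<^esub>\<close> given \<open>x\<^bsub>n\<^esub> = g\<close> for the chain \<open>RWTDI(\<omega>)\<close>.\<close>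

definition rwtdi_transition ::
  "('g, 'b) monoid_scheme \<Rightarrow> ('w \<Rightarrow> 'w) \<Rightarrow> ('w \<Rightarrow> 'g pmf) \<Rightarrow> 'w \<Rightarrow> nat \<Rightarrow> 'g \<Rightarrow> 'g pmf" where
  "rwtdi_transition G T \<mu> \<omega> n g = translate_pmf G g (\<mu> ((T ^^ n) \<omega>))"

text \<open>\<open>mu0 G T \<mu> \<omega> n\<close> is the product of the \<open>n + 1\<close> measures with indices \<open>0, \<dots>, n\<close>.\<close>

primrec mu0 :: "('g, 'b) monoid_scheme \<Rightarrow> ('w \<Rightarrow> 'w) \<Rightarrow> ('w \<Rightarrow> 'g pmf) \<Rightarrow> 'w \<Rightarrow> nat \<Rightarrow> 'g pmf" where
  "mu0 G T \<mu> \<omega> 0 = \<mu> \<omega>"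
| "mu0 G T \<mu> \<omega> (Suc n) = convolution_pmf G (mu0 G T \<mu> \<omega> n) (\<mu> ((T ^^ Suc n) \<omega>))"

text \<open>So \<open>mu0 G T \<mu> \<omega> n\<close> is the law at time \<open>n + 1\<close> of the chain started at the identity.\<close>

lemma mu0_Suc_transition:
  "mu0 G T \<mu> \<omega> (Suc n) = bind_pmf (mu0 G T \<mu> \<omega> n) (rwtdi_transition G T \<mu> \<omega> (Suc n))"
  by (simp add: convolution_pmf_def rwtdi_transition_def[abs_def] translate_pmf_def pair_pmf_def
      map_bind_pmf map_pmf_def bind_assoc_pmf bind_return_pmf del: funpow.simps)

lemma mu0_0_transition:
  assumes "group G" and "set_pmf (\<mu> \<omega>) \<subseteq> carrier G"
  shows "mu0 G T \<mu> \<omega> 0 = rwtdi_transition G T \<mu> \<omega> 0 \<one>\<^bsub>G\<^esub>"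
proof -
  interpret group G by fact
  have "map_pmf (\<lambda>x. \<one>\<^bsub>G\<^esub> \<otimes>\<^bsub>G\<^esub> x) (\<mu> \<omega>) = map_pmf (\<lambda>x. x) (\<mu> \<omega>)"
    using assms(2) by (intro map_pmf_cong) auto
  then show ?thesis
    by (simp add: rwtdi_transition_def translate_pmf_def)
qed

definition finite_first_moment ::
  "('g, 'b) monoid_scheme \<Rightarrow> 'g set \<Rightarrow> 'w measure \<Rightarrow> ('w \<Rightarrow> 'g pmf) \<Rightarrow> bool" where
  "finite_first_moment G S M \<mu> \<longleftrightarrow>
     (\<integral>\<^sup>+ \<omega>. (\<integral>\<^sup>+ g. ennreal (real (word_length G S g) * pmf (\<mu> \<omega>) g) \<partial>count_space (carrier G)) \<partial>M) < \<infinity>"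

definition rwtdi_irreducible ::
  "('g, 'b) monoid_scheme \<Rightarrow> ('w \<Rightarrow> 'w) \<Rightarrow> ('w \<Rightarrow> 'g pmf) \<Rightarrow> 'w \<Rightarrow> bool" where
  "rwtdi_irreducible G T \<mu> \<omega> \<longleftrightarrow>
     generate G {g \<in> carrier G. \<exists>n. \<not> mutually_singular
       (measure_pmf (mu0 G T \<mu> \<omega> n)) (measure_pmf (translate_pmf G g (mu0 G T \<mu> \<omega> n)))} = carrier G"

definition rwrtp_irreducible ::
  "('g, 'b) monoid_scheme \<Rightarrow> 'w measure \<Rightarrow> ('w \<Rightarrow> 'w) \<Rightarrow> ('w \<Rightarrow> 'g pmf) \<Rightarrow> bool" where
  "rwrtp_irreducible G M T \<mu> \<longleftrightarrow> (AE \<omega> in M. rwtdi_irreducible G T \<mu> \<omega>)"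

end

theory Submission
  imports Defs "HOL-Real_Asymp.Real_Asymp"
begin

text \<open>
  The proof compares entropies.  Write \<open>H p\<close> for the Shannon entropy of \<open>p\<close>, and split the
  walk at time \<open>k + 1\<close>: the measure \<open>q\<^sub>n\<close> of index \<open>n + k + 1\<close> is the convolution \<open>\<alpha> \<nu>\<^sub>n\<close>, where
  \<open>\<alpha>\<close> is the measure of index \<open>k\<close> for \<open>\<omega>\<close> and \<open>\<nu>\<^sub>n\<close> the measure of index \<open>n\<close> for \<open>T\<^sup>k\<^sup>+\<^sup>1 \<omega>\<close>.
  The gain \<open>H q\<^sub>n - H \<nu>\<^sub>n\<close> is the \<open>\<alpha>\<close>-average over \<open>x\<close> of the relative entropy of \<open>x \<nu>\<^sub>n\<close> with respect
  to \<open>q\<^sub>n\<close> (the mutual information between the positions at times \<open>k + 1\<close> and \<open>n + k + 2\<close>), and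
  relative entropy dominates a quarter of the squared total variation norm
  (\<open>gibbs_inequality_tv\<close>, \<open>pmf_entropy_convolution\<close>).  So a small gain forces
  \<open>x \<nu>\<^sub>n\<close> to be close to \<open>q\<^sub>n\<close> for every \<open>x\<close> charged by \<open>\<alpha>\<close>.

  The gains are small because entropy grows sublinearly.  A finitely generated nilpotent group
  has polynomial growth (\<open>nilpotent_polynomial_growth\<close>), hence \<open>\<Sum>\<^sub>g exp (- \<epsilon> \<bar>g\<bar>)\<close> is finite for every
  \<open>\<epsilon> > 0\<close>, and Gibbs' inequality bounds \<open>H p\<close> by \<open>\<epsilon>\<close> times the mean length of \<open>p\<close> plus this sum.
  The mean length of the walk, integrated over \<open>\<omega>\<close>, grows at most linearly by the first moment condition
  and invariance of \<open>\<lambda>\<close>, so the mean entropy \<open>h\<^sub>n\<close> is at most \<open>\<epsilon> n\<close> plus a constant, for every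
  \<open>\<epsilon> > 0\<close> (\<open>mean_entropy_sublinear\<close>).  Since \<open>T\<close> preserves \<open>\<lambda>\<close>, the integral of the gain is
  \<open>h\<^bsub>n+k+1\<^esub> - h\<^sub>n\<close>, whose infimum over \<open>n\<close> vanishes; thus for a.e. \<open>\<omega>\<close> the infimum of the gains
  vanishes (\<open>AE_entropy_gain_vanishes\<close>).  Total variation decreases along the walk, which turns the
  infimum into a limit: \<open>\<parallel>x \<nu>\<^sub>n - q\<^sub>n\<parallel>\<close> tends to \<open>0\<close> (\<open>tv_translate_vanishes\<close>).

  If \<open>\<alpha>\<close> and \<open>g \<alpha>\<close> are not mutually singular, then some \<open>h = g y\<close> has \<open>h\<close> and \<open>y\<close> both charged by
  \<open>\<alpha>\<close>, and \<open>g q\<^sub>n\<close> is close to \<open>g y \<nu>\<^sub>n = h \<nu>\<^sub>n\<close>, which is close to \<open>q\<^sub>n\<close>.  The elements \<open>g\<close> for which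
  \<open>g q\<^sub>n - q\<^sub>n\<close> tends to \<open>0\<close> form a subgroup, so irreducibility yields all of \<open>G\<close>.
\<close>

section \<open>Total variation and entropy of probability mass functions\<close>

text \<open>The relative entropy of \<open>p\<close> with respect to \<open>q\<close> dominates the squared Hellinger distance, and
  the free parameter \<open>\<delta>\<close> replaces the Cauchy--Schwarz inequality that would then be needed to reach the
  total variation norm: summed over all points, the inequality stays linear in \<open>\<bar>p - q\<bar>\<close>, and \<open>\<delta>\<close> is
  optimised only afterwards.  For \<open>\<delta> = 0\<close> it is the pointwise form of Gibbs' inequality.\<close>
lemma log_ratio_lower_bound:
  fixes p q \<delta> :: real
  assumes p: "0 \<le> p" and q: "0 \<le> q" and pos: "0 < p \<Longrightarrow> 0 < q"
  shows "p * - ln p + p + \<delta> * \<bar>p - q\<bar> \<le> p * - ln q + q + \<delta>\<^sup>2 * (p + q) / 2"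
proof -
  \<comment> \<open>The Hellinger term is \<open>(a - b)\<^sup>2\<close>; the \<open>\<delta>\<close>-terms come from completing a square.\<close>
  define a b where "a = sqrt p" and "b = sqrt q"
  have ab: "0 \<le> a" "0 \<le> b" "p = a\<^sup>2" "q = b\<^sup>2"
    using p q by (auto simp: a_def b_def)
  have log: "p * (ln q - ln p) \<le> 2 * a * b - 2 * a\<^sup>2"
  proof (cases "p = 0")
    case True
    with ab show ?thesis by simp
  next
    case False
    with p have "0 < p" "0 < q" using pos by auto
    then have "0 < a" "0 < b" by (auto simp: a_def b_def)
    have "ln q - ln p = 2 * ln (b / a)"
      using \<open>0 < a\<close> \<open>0 < b\<close> by (simp add: ab ln_div ln_realpow)
    also have "\<dots> \<le> 2 * (b / a - 1)"
      using ln_le_minus_one[of "b / a"] \<open>0 < a\<close> \<open>0 < b\<close> by simp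
    finally have "a\<^sup>2 * (ln q - ln p) \<le> a\<^sup>2 * (2 * (b / a - 1))"
      by (intro mult_left_mono) auto
    also have "\<dots> = 2 * a * b - 2 * a\<^sup>2"
      using \<open>0 < a\<close> by (simp add: field_simps power2_eq_square)
    finally show ?thesis by (simp add: ab)
  qed
  have "\<bar>p - q\<bar> = \<bar>a - b\<bar> * (a + b)"
  proof -
    have "p - q = (a - b) * (a + b)" by (simp add: ab power2_eq_square algebra_simps)
    then show ?thesis using ab by (simp add: abs_mult)
  qed
  moreover have "0 \<le> (\<bar>a - b\<bar> - \<delta> * (a + b) / 2)\<^sup>2" by simp
  then have "\<delta> * (\<bar>a - b\<bar> * (a + b)) \<le> \<bar>a - b\<bar>\<^sup>2 + \<delta>\<^sup>2 * (a + b)\<^sup>2 / 4"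
    by (simp add: power2_eq_square algebra_simps)
  moreover have "\<delta>\<^sup>2 * (a + b)\<^sup>2 \<le> \<delta>\<^sup>2 * (2 * (p + q))"
  proof (rule mult_left_mono)
    have "0 \<le> (a - b)\<^sup>2" by simp
    then show "(a + b)\<^sup>2 \<le> 2 * (p + q)" by (simp add: ab power2_eq_square algebra_simps)
  qed simp
  moreover have "\<bar>a - b\<bar>\<^sup>2 = p + q - 2 * a * b"
    by (simp add: ab power2_eq_square algebra_simps)
  moreover have "p * - ln p + p = p - p * ln p" "p * - ln q + q = q - p * ln q" "2 * a\<^sup>2 = 2 * p"
    "p * (ln q - ln p) = p * ln q - p * ln p"
    by (simp_all add: algebra_simps ab(3))
  moreover have "\<delta>\<^sup>2 * (2 * (p + q)) = 4 * (\<delta>\<^sup>2 * (p + q) / 2)" by simp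
  moreover have "\<delta> * \<bar>p - q\<bar> = \<delta> * (\<bar>a - b\<bar> * (a + b))" by (simp only: calculation(1))
  ultimately show ?thesis using log
    by linarith
qed

definition pmf_tv :: "'a pmf \<Rightarrow> 'a pmf \<Rightarrow> real" where
  "pmf_tv p q = tv_norm (\<lambda>x. pmf p x - pmf q x)"

lemma pmf_diff_summable: "(\<lambda>x. \<bar>pmf p x - pmf q x\<bar>) summable_on UNIV"
proof -
  have s: "(\<lambda>x. norm (pmf r x)) summable_on UNIV" for r :: "'a pmf"
    using pmf_abs_summable[of r UNIV] by (simp only: abs_summable_equivalent[symmetric])
  show ?thesis
    by (rule summable_on_comparison_test[OF summable_on_add[OF s[of p] s[of q]]]) (auto intro: order_trans[OF abs_triangle_ineq4])
qed

lemma ennreal_pmf_tv: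
  "ennreal (pmf_tv p q) = (\<integral>\<^sup>+ x. ennreal \<bar>pmf p x - pmf q x\<bar> \<partial>count_space UNIV)"
proof -
  have "(\<lambda>x. norm \<bar>pmf p x - pmf q x\<bar>) summable_on UNIV"
    using pmf_diff_summable[of p q] by simp
  note abs = this[unfolded abs_summable_equivalent]
  show ?thesis
    unfolding pmf_tv_def tv_norm_def
    using nn_integral_conv_infsetsum[OF abs] infsetsum_infsum[OF abs] by simp
qed

lemma pmf_tv_nonneg: "0 \<le> pmf_tv p q"
  unfolding pmf_tv_def tv_norm_def by (rule infsum_nonneg) simp

lemma pmf_tv_self [simp]: "pmf_tv p p = 0"
  by (simp add: pmf_tv_def tv_norm_def)

lemma pmf_tv_commute: "pmf_tv p q = pmf_tv q p"
  unfolding pmf_tv_def tv_norm_def by (intro infsum_cong) auto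

lemma pmf_tv_triangle: "pmf_tv p r \<le> pmf_tv p q + pmf_tv q r"
  unfolding pmf_tv_def tv_norm_def
  by (subst infsum_add[OF pmf_diff_summable pmf_diff_summable, symmetric],
      intro infsum_mono summable_on_add pmf_diff_summable) auto

text \<open>A Markov kernel contracts total variation.  This is what makes the distance between two walks with
  the same future increments decrease in time.\<close>
lemma pmf_tv_bind_le: "pmf_tv (bind_pmf p f) (bind_pmf q f) \<le> pmf_tv p q"
proof -
  let ?d = "\<lambda>x. ennreal \<bar>pmf p x - pmf q x\<bar>"
  define R where "R y = (\<integral>\<^sup>+ x. ?d x * ennreal (pmf (f x) y) \<partial>count_space UNIV)" for y
  have le: "ennreal (pmf (bind_pmf p f) y) \<le> ennreal (pmf (bind_pmf q f) y) + R y"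
    if "\<And>x. ?d x = ennreal \<bar>pmf p x - pmf q x\<bar>" for p q y
  proof -
    have "ennreal (pmf (bind_pmf p f) y)
        \<le> (\<integral>\<^sup>+ x. ennreal (pmf q x) * ennreal (pmf (f x) y) + ?d x * ennreal (pmf (f x) y)
             \<partial>count_space UNIV)"
      unfolding ennreal_pmf_bind nn_integral_measure_pmf that distrib_right[symmetric]
      by (intro nn_integral_mono mult_right_mono) (auto simp flip: ennreal_plus)
    also have "\<dots> = ennreal (pmf (bind_pmf q f) y) + R y"
      by (subst nn_integral_add) (auto simp: R_def ennreal_pmf_bind nn_integral_measure_pmf)
    finally show ?thesis .
  qed
  have "ennreal \<bar>pmf (bind_pmf p f) y - pmf (bind_pmf q f) y\<bar> \<le> R y" for y
  proof (cases "R y")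
    case (real r)
    with le[of p q y] le[of q p y] show ?thesis
      by (auto simp: abs_minus_commute simp flip: ennreal_plus)
  qed simp
  then have "ennreal (pmf_tv (bind_pmf p f) (bind_pmf q f)) \<le> (\<integral>\<^sup>+ y. R y \<partial>count_space UNIV)"
    unfolding ennreal_pmf_tv by (intro nn_integral_mono)
  also have "\<dots> = (\<integral>\<^sup>+ x. \<integral>\<^sup>+ y. ?d x * ennreal (pmf (f x) y) \<partial>count_space UNIV \<partial>count_space UNIV)"
    unfolding R_def
    using nn_integral_fst_count_space[of "\<lambda>(y, x). ?d x * ennreal (pmf (f x) y)"]
      nn_integral_snd_count_space[of "\<lambda>(y, x). ?d x * ennreal (pmf (f x) y)"] by simp
  also have "\<dots> = ennreal (pmf_tv p q)"
    by (simp add: nn_integral_cmult nn_integral_pmf ennreal_pmf_tv)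
  finally show ?thesis
    by (simp add: pmf_tv_nonneg)
qed

lemma pmf_tv_map_le: "pmf_tv (map_pmf f p) (map_pmf f q) \<le> pmf_tv p q"
  unfolding map_pmf_def by (rule pmf_tv_bind_le)

definition pmf_entropy :: "'a pmf \<Rightarrow> ennreal" where
  "pmf_entropy p = (\<integral>\<^sup>+ x. ennreal (- ln (pmf p x)) \<partial>measure_pmf p)"

text \<open>A weak form of Pinsker's inequality, with the relative entropy written as cross entropy minus entropy
  and the entropy moved to the other side, so that it makes sense for infinite entropies as well.  As
  \<open>ln 0 = 0\<close> here, the inclusion of supports excludes the case of infinite relative entropy.\<close>
lemma gibbs_inequality_tv:
  assumes "set_pmf p \<subseteq> set_pmf q"
  shows "pmf_entropy p + ennreal ((pmf_tv p q)\<^sup>2 / 4) \<le> (\<integral>\<^sup>+ x. ennreal (- ln (pmf q x)) \<partial>measure_pmf p)"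
proof -
  define t where "t = pmf_tv p q"
  \<comment> \<open>This \<open>\<delta>\<close> maximises \<open>\<delta> t - \<delta>\<^sup>2\<close>, with maximum \<open>t\<^sup>2 / 4\<close>.\<close>
  define \<delta> where "\<delta> = t / 2"
  have t0: "0 \<le> t" by (simp add: t_def pmf_tv_nonneg)
  have \<delta>0: "0 \<le> \<delta>" by (simp add: \<delta>_def t0)
  let ?C = "\<integral>\<^sup>+ x. ennreal (- ln (pmf q x)) \<partial>measure_pmf p"
  \<comment> \<open>The total masses are kept as summands \<open>1\<close> on both sides, because the difference of the two
    densities is not of constant sign.\<close>
  have "pmf_entropy p + 1 + ennreal (\<delta> * t)
     = (\<integral>\<^sup>+ x. ennreal (pmf p x) * ennreal (- ln (pmf p x)) + ennreal (pmf p x)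
          + ennreal \<delta> * ennreal \<bar>pmf p x - pmf q x\<bar> \<partial>count_space UNIV)"
    by (simp add: nn_integral_add nn_integral_cmult pmf_entropy_def nn_integral_measure_pmf
        nn_integral_pmf ennreal_mult \<delta>0 t0 flip: ennreal_pmf_tv t_def)
  also have "\<dots> \<le> (\<integral>\<^sup>+ x. ennreal (pmf p x) * ennreal (- ln (pmf q x)) + ennreal (pmf q x)
          + ennreal (\<delta>\<^sup>2 / 2) * (ennreal (pmf p x) + ennreal (pmf q x)) \<partial>count_space UNIV)"
  proof (rule nn_integral_mono)
    fix x
    have pos: "0 < pmf p x \<Longrightarrow> 0 < pmf q x"
      using assms by (auto simp: pmf_positive_iff)
    have ln0: "0 \<le> - ln (pmf r x)" for r :: "'a pmf"
      by (cases "pmf r x = 0") (auto simp: pmf_le_1 ln_le_zero_iff pmf_nonneg less_le)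
    show "ennreal (pmf p x) * ennreal (- ln (pmf p x)) + ennreal (pmf p x)
          + ennreal \<delta> * ennreal \<bar>pmf p x - pmf q x\<bar>
       \<le> ennreal (pmf p x) * ennreal (- ln (pmf q x)) + ennreal (pmf q x)
          + ennreal (\<delta>\<^sup>2 / 2) * (ennreal (pmf p x) + ennreal (pmf q x))"
    proof -
      have "ennreal (pmf p x) * ennreal (- ln (pmf p x)) + ennreal (pmf p x)
            + ennreal \<delta> * ennreal \<bar>pmf p x - pmf q x\<bar>
          = ennreal (pmf p x * - ln (pmf p x) + pmf p x + \<delta> * \<bar>pmf p x - pmf q x\<bar>)"
        using ln0[of p] \<delta>0 mult_nonneg_nonneg[OF pmf_nonneg ln0]
        by (simp only: ennreal_plus ennreal_mult pmf_nonneg abs_ge_zero mult_nonneg_nonneg add_nonneg_nonneg)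
      moreover have "ennreal (pmf p x) * ennreal (- ln (pmf q x)) + ennreal (pmf q x)
            + ennreal (\<delta>\<^sup>2 / 2) * (ennreal (pmf p x) + ennreal (pmf q x))
          = ennreal (pmf p x * - ln (pmf q x) + pmf q x + \<delta>\<^sup>2 / 2 * (pmf p x + pmf q x))"
        using ln0[of q] mult_nonneg_nonneg[OF pmf_nonneg ln0]
        by (subst ennreal_plus, simp_all only: ennreal_plus ennreal_mult pmf_nonneg mult_nonneg_nonneg
              add_nonneg_nonneg zero_le_power2 divide_nonneg_nonneg zero_le_numeral)
      ultimately show ?thesis
        using log_ratio_lower_bound[of "pmf p x" "pmf q x" \<delta>] pos
        by (simp add: ennreal_leI)
    qed
  qed
  also have "\<dots> = ?C + 1 + ennreal (\<delta>\<^sup>2)"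
  proof -
    have "ennreal (\<delta>\<^sup>2 / 2) * 2 = ennreal (\<delta>\<^sup>2)"
      by (simp flip: ennreal_mult'' ennreal_numeral)
    then show ?thesis
      by (simp add: nn_integral_add nn_integral_cmult nn_integral_measure_pmf nn_integral_pmf
          del: ennreal_numeral)
  qed
  finally have "pmf_entropy p + 1 + ennreal (\<delta> * t) \<le> ?C + 1 + ennreal (\<delta>\<^sup>2)" .
  then show ?thesis
  proof -
    have *: "\<delta> * t = \<delta>\<^sup>2 + t\<^sup>2 / 4" "0 \<le> t\<^sup>2 / 4" "0 \<le> \<delta>\<^sup>2"
      by (auto simp: \<delta>_def power2_eq_square)
    have "(pmf_entropy p + ennreal (t\<^sup>2 / 4)) + (1 + ennreal (\<delta>\<^sup>2)) \<le> ?C + (1 + ennreal (\<delta>\<^sup>2))"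
      using \<open>pmf_entropy p + 1 + ennreal (\<delta> * t) \<le> _\<close> unfolding * using *(2,3)
      by (simp add: ac_simps)
    then show ?thesis
      unfolding t_def[symmetric] by (simp add: ennreal_add_left_cancel_le add.commute)
  qed
qed

text \<open>Gibbs' inequality against the weight \<open>exp (- l)\<close>.  The weight need not be normalised: its total mass
  takes the place of the logarithm of the partition function.\<close>
lemma pmf_entropy_le_exponential_weight:
  fixes l :: "'a \<Rightarrow> real"
  assumes l: "\<And>x. 0 \<le> l x" and A: "set_pmf p \<subseteq> A"
  shows "pmf_entropy p \<le> (\<integral>\<^sup>+ x. ennreal (l x) \<partial>measure_pmf p)
                          + (\<integral>\<^sup>+ x. ennreal (exp (- l x)) \<partial>count_space A)"
proof -
  let ?i = "\<lambda>x. indicator A x :: ennreal"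
  have "pmf_entropy p \<le> (\<integral>\<^sup>+ x. ennreal (pmf p x) * ennreal (l x)
         + ennreal (exp (- l x)) * ?i x \<partial>count_space UNIV)"
    unfolding pmf_entropy_def nn_integral_measure_pmf
  proof (rule nn_integral_mono)
    fix x
    show "ennreal (pmf p x) * ennreal (- ln (pmf p x))
      \<le> ennreal (pmf p x) * ennreal (l x) + ennreal (exp (- l x)) * ?i x"
    proof (cases "x \<in> set_pmf p")
      case True
      have ln0: "0 \<le> - ln (pmf p x)"
        using True by (auto simp: pmf_le_1 ln_le_zero_iff pmf_positive)
      have "pmf p x * - ln (pmf p x) \<le> pmf p x * l x + exp (- l x)"
        using log_ratio_lower_bound[of "pmf p x" "exp (- l x)" 0] pmf_nonneg[of p x]
        by (simp, linarith)
      with True A ln0 l show ?thesis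
        by (auto simp: subset_iff mult_nonneg_nonneg
              simp flip: ennreal_mult ennreal_plus simp del: mult_minus_right)
    next
      case False
      then show ?thesis by (simp add: set_pmf_iff)
    qed
  qed
  also have "\<dots> = (\<integral>\<^sup>+ x. ennreal (l x) \<partial>measure_pmf p)
                  + (\<integral>\<^sup>+ x. ennreal (exp (- l x)) \<partial>count_space A)"
    by (simp add: nn_integral_add nn_integral_measure_pmf nn_integral_count_space_indicator)
  finally show ?thesis .
qed

lemma pmf_entropy_map_inj:
  assumes "inj_on f (set_pmf p)"
  shows "pmf_entropy (map_pmf f p) = pmf_entropy p"
  unfolding pmf_entropy_def nn_integral_map_pmf
  by (intro nn_integral_cong_AE) (auto simp: AE_measure_pmf_iff pmf_map_inj assms)

section \<open>Polynomial growth of nilpotent groups\<close>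

context group
begin

abbreviation wprod :: "'a list \<Rightarrow> 'a" where
  "wprod xs \<equiv> foldr (\<otimes>) xs \<one>"

definition word_ball :: "'a set \<Rightarrow> nat \<Rightarrow> 'a set" where
  "word_ball A n = {wprod xs | xs. length xs \<le> n \<and> set xs \<subseteq> A \<union> m_inv G ` A}"

lemma wprod_closed: "set xs \<subseteq> carrier G \<Longrightarrow> wprod xs \<in> carrier G"
  by (induction xs) auto

lemma wprod_append:
  "set xs \<subseteq> carrier G \<Longrightarrow> set ys \<subseteq> carrier G \<Longrightarrow> wprod (xs @ ys) = wprod xs \<otimes> wprod ys"
proof (induction xs)
  case (Cons x xs)
  then have "wprod ((x # xs) @ ys) = x \<otimes> (wprod xs \<otimes> wprod ys)"
    by (simp del: foldr_append)
  then show ?case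
    using Cons.prems by (simp add: m_assoc wprod_closed)
qed (simp add: wprod_closed)

lemma wprod_inv:
  "set xs \<subseteq> carrier G \<Longrightarrow> inv (wprod xs) = wprod (rev (map (\<lambda>x. inv x) xs))"
proof (induction xs)
  case (Cons x xs)
  then have "set (rev (map (\<lambda>x. inv x) xs)) \<subseteq> carrier G" by auto
  then show ?case
    using Cons wprod_append[of "rev (map (\<lambda>x. inv x) xs)" "[inv x]"]
    by (simp add: inv_mult_group wprod_closed del: foldr_append)
qed simp

lemma letters_closed: "A \<subseteq> carrier G \<Longrightarrow> A \<union> m_inv G ` A \<subseteq> carrier G"
  by auto

lemma mult_inv_cancel_left:
  assumes "x \<in> carrier G" "y \<in> carrier G"
  shows "x \<otimes> (inv x \<otimes> y) = y" "inv x \<otimes> (x \<otimes> y) = y"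
  using assms by (simp_all flip: m_assoc)

lemma word_ball_closed: "A \<subseteq> carrier G \<Longrightarrow> word_ball A n \<subseteq> carrier G"
  unfolding word_ball_def using wprod_closed letters_closed by blast

lemma one_in_word_ball: "\<one> \<in> word_ball A n"
  unfolding word_ball_def by (rule CollectI, rule exI[of _ "[]"]) simp

lemma letter_in_word_ball: "a \<in> A \<Longrightarrow> a \<in> carrier G \<Longrightarrow> 1 \<le> n \<Longrightarrow> a \<in> word_ball A n"
  unfolding word_ball_def by (rule CollectI, rule exI[of _ "[a]"]) simp

lemma word_ball_mono: "A \<subseteq> B \<Longrightarrow> m \<le> n \<Longrightarrow> word_ball A m \<subseteq> word_ball B n"
  unfolding word_ball_def by (auto; blast intro: order_trans)

lemma word_ball_mult:
  assumes "A \<subseteq> carrier G" "x \<in> word_ball A m" "y \<in> word_ball A n"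
  shows "x \<otimes> y \<in> word_ball A (m + n)"
proof -
  obtain xs ys where "x = wprod xs" "length xs \<le> m" "set xs \<subseteq> A \<union> m_inv G ` A"
     "y = wprod ys" "length ys \<le> n" "set ys \<subseteq> A \<union> m_inv G ` A"
    using assms(2,3) unfolding word_ball_def by auto
  moreover from this have "x \<otimes> y = wprod (xs @ ys)"
    using letters_closed[OF assms(1)] wprod_append[of xs ys] by (simp add: subset_trans del: foldr_append)
  ultimately show ?thesis
    unfolding word_ball_def by (intro CollectI exI[of _ "xs @ ys"]) auto
qed

lemma word_ball_inv:
  assumes "A \<subseteq> carrier G" "x \<in> word_ball A n"
  shows "inv x \<in> word_ball A n"
proof -
  obtain xs where xs: "x = wprod xs" "length xs \<le> n" "set xs \<subseteq> A \<union> m_inv G ` A"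
    using assms(2) unfolding word_ball_def by auto
  then have "inv x = wprod (rev (map (\<lambda>x. inv x) xs))"
    using letters_closed[OF assms(1)] by (simp add: wprod_inv subset_trans)
  moreover have "(\<lambda>x. inv x) ` set xs \<subseteq> A \<union> m_inv G ` A"
    using xs(3) assms(1) by (force simp: subset_iff)
  ultimately show ?thesis
    unfolding word_ball_def using xs(2)
    by (intro CollectI exI[of _ "rev (map (\<lambda>x. inv x) xs)"]) auto
qed

lemma finite_word_ball:
  assumes "finite A"
  shows "finite (word_ball A n)"
proof -
  have "word_ball A n = wprod ` {xs. set xs \<subseteq> A \<union> m_inv G ` A \<and> length xs \<le> n}"
    unfolding word_ball_def by auto
  then show ?thesis
    using finite_lists_length_le[of "A \<union> m_inv G ` A" n] assms by simp
qed

lemma word_ball_Suc_cases: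
  assumes "w \<in> word_ball A (Suc n)"
  shows "w = \<one> \<or> (\<exists>x\<in>A \<union> m_inv G ` A. \<exists>v\<in>word_ball A n. w = x \<otimes> v)"
proof -
  obtain xs where xs: "w = wprod xs" "length xs \<le> Suc n" "set xs \<subseteq> A \<union> m_inv G ` A"
    using assms unfolding word_ball_def by auto
  show ?thesis
  proof (cases xs)
    case Nil
    with xs show ?thesis by simp
  next
    case (Cons x ys)
    with xs have "wprod ys \<in> word_ball A n"
      unfolding word_ball_def by auto
    with Cons xs show ?thesis by auto
  qed
qed

lemma generate_imp_word_ball:
  assumes A: "A \<subseteq> carrier G" and g: "g \<in> generate G A"
  shows "\<exists>n. g \<in> word_ball A n"
  using g
proof induction
  case one
  show ?case using one_in_word_ball by blast
next
  case (incl h)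
  then show ?case using A letter_in_word_ball[of h A 1] by blast
next
  case (inv h)
  then show ?case using A word_ball_inv[OF A letter_in_word_ball[of h A 1]] by blast
next
  case (eng x y)
  then show ?case using word_ball_mult[OF A] by blast
qed

lemma word_length_le: "g \<in> word_ball S n \<Longrightarrow> word_length G S g \<le> n"
  unfolding word_length_def word_ball_def by (blast intro: Least_le order_trans)

lemma in_word_ball_word_length:
  assumes "g \<in> word_ball S n"
  shows "g \<in> word_ball S (word_length G S g)"
proof -
  let ?P = "\<lambda>n. \<exists>xs. length xs = n \<and> set xs \<subseteq> S \<union> (\<lambda>s. inv s) ` S \<and> g = wprod xs"
  have "\<exists>n. ?P n" using assms unfolding word_ball_def by auto
  then have "?P (word_length G S g)"
    unfolding word_length_def by (rule LeastI_ex)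
  then show ?thesis unfolding word_ball_def by auto
qed

lemma word_length_mult_le:
  assumes S: "S \<subseteq> carrier G" "generate G S = carrier G" and "g \<in> carrier G" "h \<in> carrier G"
  shows "word_length G S (g \<otimes> h) \<le> word_length G S g + word_length G S h"
proof -
  have "x \<in> word_ball S (word_length G S x)" if "x \<in> carrier G" for x
    using generate_imp_word_ball[OF S(1)] that S(2) in_word_ball_word_length by blast
  then show ?thesis
    using assms by (intro word_length_le word_ball_mult[OF S(1)]) auto
qed

lemma lower_central_subgroup: "subgroup (lower_central G k) G"
proof (induction k)
  case 0
  show ?case by (simp add: subgroup_self)
next
  case (Suc k)
  then have "lower_central G k \<subseteq> carrier G" by (rule subgroup.subset)
  then show ?case by (auto intro!: generate_is_subgroup)
qed

lemma lower_central_closed: "lower_central G k \<subseteq> carrier G"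
  using lower_central_subgroup by (rule subgroup.subset)

lemma commutator_in_lower_central:
  assumes "x \<in> lower_central G k" "y \<in> carrier G"
  shows "x \<otimes> y \<otimes> inv x \<otimes> inv y \<in> lower_central G (Suc k)"
  using assms by (auto intro!: generate.incl)

lemma lower_central_Suc_subset: "lower_central G (Suc k) \<subseteq> lower_central G k"
proof (induction k)
  case 0
  show ?case using lower_central_closed[of "Suc 0"] by simp
next
  case (Suc k)
  then show ?case
    by (simp only: lower_central.simps(2)[of G "Suc k"])
       (subst lower_central.simps(2), intro mono_generate, blast)
qed

lemma lower_central_antimono: "j \<le> k \<Longrightarrow> lower_central G k \<subseteq> lower_central G j"
  using lower_central_Suc_subset by (rule lift_Suc_antimono_le)

definition commutator_with :: "'a \<Rightarrow> 'a \<Rightarrow> 'a" where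
  "commutator_with t a = a \<otimes> t \<otimes> inv a \<otimes> inv t"

lemma commutator_with_closed: "t \<in> carrier G \<Longrightarrow> a \<in> carrier G \<Longrightarrow> commutator_with t a \<in> carrier G"
  by (simp add: commutator_with_def)

text \<open>In a nilpotent group the iterates of \<open>commutator_with t\<close> therefore become trivial.\<close>
lemma commutator_with_iter_lower_central:
  assumes "t \<in> carrier G" "a \<in> lower_central G k"
  shows "(commutator_with t ^^ i) a \<in> lower_central G (k + i)"
proof (induction i)
  case (Suc i)
  then show ?case
    using commutator_in_lower_central[OF Suc assms(1)] by (simp add: commutator_with_def)
qed (use assms in simp)

lemma conj_eq_commutator_with:
  "t \<in> carrier G \<Longrightarrow> a \<in> carrier G \<Longrightarrow> t \<otimes> a \<otimes> inv t = inv (commutator_with t a) \<otimes> a"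
  by (simp add: commutator_with_def inv_mult_group m_assoc)

text \<open>The identity \<open>t a t\<^sup>-\<^sup>1 = [a, t]\<^sup>-\<^sup>1 a\<close> is a Pascal recursion for the number of letters of
  \<open>t\<^sup>m a t\<^sup>-\<^sup>m\<close>, written in the iterated commutators of \<open>a\<close> with \<open>t\<close>.  As these become trivial after \<open>N\<close>
  steps, the number is polynomial in \<open>m\<close>; the exponent \<open>j\<close> counts the commutators that can still be formed.\<close>
lemma conj_pow_in_word_ball:
  assumes t: "t \<in> carrier G" and a: "a \<in> carrier G"
    and nil: "\<And>i. N \<le> i \<Longrightarrow> (commutator_with t ^^ i) a = \<one>"
    and A: "A \<subseteq> carrier G" "\<And>i. i < N \<Longrightarrow> (commutator_with t ^^ i) a \<in> A"
    and "N \<le> i + j"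
  shows "t [^] m \<otimes> (commutator_with t ^^ i) a \<otimes> inv (t [^] m) \<in> word_ball A ((m + 1) ^ j)"
  using \<open>N \<le> i + j\<close>
proof (induction m arbitrary: i j)
  case 0
  have "(commutator_with t ^^ i) a \<in> word_ball A 1"
    using A nil[of i] letter_in_word_ball[of "(commutator_with t ^^ i) a" A 1]
    by (cases "i < N") (auto simp: one_in_word_ball)
  moreover from this have "(commutator_with t ^^ i) a \<in> carrier G"
    using word_ball_closed[OF A(1)] by blast
  ultimately show ?case by simp
next
  case (Suc m)
  show ?case
  proof (cases j)
    case 0
    then show ?thesis using nil[of i] Suc.prems t by (simp add: one_in_word_ball)
  next
    case (Suc l)
    define b where "b = (commutator_with t ^^ i) a"
    have b: "b \<in> carrier G" "commutator_with t b = (commutator_with t ^^ Suc i) a"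
      unfolding b_def by (induction i) (auto simp: a t commutator_with_closed)
    let ?c = "\<lambda>x. t [^] m \<otimes> x \<otimes> inv (t [^] m)"
    have cl: "t [^] m \<in> carrier G" "commutator_with t b \<in> carrier G"
      using t b(1) by (auto simp: commutator_with_closed)
    have "t [^] Suc m \<otimes> b \<otimes> inv (t [^] Suc m) = ?c (t \<otimes> b \<otimes> inv t)"
      using t b cl by (simp add: m_assoc inv_mult_group)
    also have "t \<otimes> b \<otimes> inv t = inv (commutator_with t b) \<otimes> b"
      by (rule conj_eq_commutator_with[OF t b(1)])
    also have "?c (inv (commutator_with t b) \<otimes> b) = inv (?c (commutator_with t b)) \<otimes> ?c b"
      using t b(1) cl by (simp add: m_assoc inv_mult_group mult_inv_cancel_left)
    finally have eq: "t [^] Suc m \<otimes> b \<otimes> inv (t [^] Suc m) = inv (?c (commutator_with t b)) \<otimes> ?c b" .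
    have "?c (commutator_with t b) \<in> word_ball A ((m + 1) ^ l)"
      using Suc.IH[of "Suc i" l] Suc.prems unfolding b(2) Suc by simp
    moreover have "?c b \<in> word_ball A ((m + 1) ^ j)"
      using Suc.IH[of i j] Suc.prems unfolding b_def by simp
    ultimately have "t [^] Suc m \<otimes> b \<otimes> inv (t [^] Suc m) \<in> word_ball A ((m + 1) ^ l + (m + 1) ^ j)"
      unfolding eq by (intro word_ball_mult word_ball_inv A)
    moreover have "(m + 1) ^ l + (m + 1) ^ j \<le> (Suc m + 1) ^ j"
    proof -
      have "(m + 1) ^ l + (m + 1) ^ j = (m + 1) ^ l * (m + 2)" by (simp add: Suc algebra_simps)
      also have "\<dots> \<le> (m + 2) ^ l * (m + 2)" by (intro mult_right_mono power_mono) auto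
      finally show ?thesis by (simp add: Suc mult.commute)
    qed
    ultimately show ?thesis
      using word_ball_mono[OF subset_refl] b_def by blast
  qed
qed

definition polynomial_growth :: "'a set \<Rightarrow> bool" where
  "polynomial_growth A \<longleftrightarrow> (\<exists>C d. \<forall>n. card (word_ball A n) \<le> C * (n + 1) ^ d)"

text \<open>An alphabet for what remains of a word over \<open>A\<close> after all occurrences of \<open>s\<close> have been moved to
  its front.  Commutators with the inverse of \<open>s\<close> are included because \<open>conj_pow_in_word_ball\<close> treats
  nonnegative powers only.\<close>
definition eliminate :: "nat \<Rightarrow> 'a \<Rightarrow> 'a set \<Rightarrow> 'a set" where
  "eliminate N s A = (\<Union>t\<in>{s, inv s}. \<Union>i<N. (commutator_with t ^^ i) ` (A - {s}))"

text \<open>A word is read from the right, keeping it in the form \<open>t\<^sup>-\<^sup>m v\<close>.  A letter \<open>s\<close> or its inverse changes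
  only the power; any other letter \<open>x\<close> is moved past the power, where it becomes \<open>t\<^sup>m x t\<^sup>-\<^sup>m\<close>, which costs
  polynomially many letters.\<close>
lemma word_ball_eliminate:
  assumes A: "A \<subseteq> carrier G" and s: "s \<in> carrier G"
    and nil: "\<And>t a i. t \<in> carrier G \<Longrightarrow> a \<in> carrier G \<Longrightarrow> N \<le> i \<Longrightarrow> (commutator_with t ^^ i) a = \<one>"
  assumes "w \<in> word_ball A n"
  shows "\<exists>t\<in>{s, inv s}. \<exists>m\<le>n. \<exists>v\<in>word_ball (eliminate N s A) (n * (n + 1) ^ N). w = inv (t [^] m) \<otimes> v"
  using \<open>w \<in> word_ball A n\<close>
proof (induction n arbitrary: w)
  case 0
  then have "w = \<one>" by (simp add: word_ball_def)
  then show ?case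
    by (intro bexI[of _ s] exI[of _ 0] conjI bexI[of _ \<one>]) (auto simp: one_in_word_ball)
next
  case (Suc n)
  let ?B = "eliminate N s A"
  have iter: "(commutator_with t ^^ i) a \<in> carrier G" if "t \<in> carrier G" "a \<in> carrier G" for t a i
    using that by (induction i) (auto simp: commutator_with_closed)
  have B: "?B \<subseteq> carrier G"
    using A s iter unfolding eliminate_def by (auto simp: subset_iff)
  have mono: "word_ball ?B (n * (n + 1) ^ N) \<subseteq> word_ball ?B (Suc n * (Suc n + 1) ^ N)"
    by (intro word_ball_mono mult_mono power_mono) auto
  from word_ball_Suc_cases[OF Suc.prems] show ?case
  proof (elim disjE bexE)
    assume "w = \<one>"
    then show ?thesis
      by (intro bexI[of _ s] exI[of _ 0] conjI bexI[of _ \<one>]) (auto simp: one_in_word_ball)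
  next
    fix x w' assume x: "x \<in> A \<union> m_inv G ` A" and w': "w' \<in> word_ball A n" and w: "w = x \<otimes> w'"
    obtain t m v where t: "t \<in> {s, inv s}" and m: "m \<le> n"
      and v: "v \<in> word_ball ?B (n * (n + 1) ^ N)" and w'_eq: "w' = inv (t [^] m) \<otimes> v"
      using Suc.IH[OF w'] by blast
    have tc: "t \<in> carrier G" and vc: "v \<in> carrier G"
      using t s v word_ball_closed[OF B] by auto
    show ?thesis
    proof (cases "x \<in> {s, inv s}")
      case True
      have "x \<in> carrier G" using True s by auto
      consider "x = t" "m = 0" | k where "x = t" "m = Suc k" | "x = inv t"
        using True t s by (cases m) auto
      then show ?thesis
      proof cases
        case 1
        then have "w = inv (inv t [^] (1::nat)) \<otimes> v"
          using w w'_eq tc vc by simp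
        moreover have "inv t \<in> {s, inv s}" using t s by auto
        ultimately show ?thesis
          using v mono by (intro bexI[of _ "inv t"] exI[of _ 1]) auto
      next
        case (2 k)
        then have "w = inv (t [^] k) \<otimes> v"
          using w w'_eq tc vc by (simp add: m_assoc inv_mult_group mult_inv_cancel_left)
        then show ?thesis
          using v mono 2 m t by (intro bexI[of _ t] exI[of _ k]) auto
      next
        case 3
        then have "w = inv (t [^] Suc m) \<otimes> v"
          using w w'_eq tc vc by (simp add: m_assoc inv_mult_group)
        then show ?thesis
          using v mono m t by (intro bexI[of _ t] exI[of _ "Suc m"]) auto
      qed
    next
      case False
      let ?c = "\<lambda>x. t [^] m \<otimes> x \<otimes> inv (t [^] m)"
      have letter: "?c a \<in> word_ball ?B ((m + 1) ^ N)" if "a \<in> A - {s}" for a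
      proof -
        have ac: "a \<in> carrier G" using that A by auto
        have "(commutator_with t ^^ i) a \<in> ?B" if "i < N" for i
          using t \<open>a \<in> A - {s}\<close> that unfolding eliminate_def by blast
        from conj_pow_in_word_ball[OF tc ac nil[OF tc ac] B this, of N 0 N m]
        show ?thesis by simp
      qed
      have "x \<in> carrier G" using x A by auto
      have "?c x \<in> word_ball ?B ((m + 1) ^ N)"
      proof (cases "x \<in> A")
        case True
        then show ?thesis using False letter by auto
      next
        case notA: False
        then obtain a where a: "a \<in> A" "x = inv a" using x by auto
        then have "a \<in> A - {s}" using False by auto
        moreover have "?c x = inv (?c a)"
          using a A tc by (auto simp: inv_mult_group m_assoc subset_iff)
        ultimately show ?thesis
          using letter word_ball_inv[OF B] by simp
      qed
      then have "?c x \<otimes> v \<in> word_ball ?B ((m + 1) ^ N + n * (n + 1) ^ N)"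
        by (rule word_ball_mult[OF B]) (rule v)
      moreover have "(m + 1) ^ N + n * (n + 1) ^ N \<le> Suc n * (Suc n + 1) ^ N"
      proof -
        have "(m + 1) ^ N \<le> (n + 1) ^ N" using m by (intro power_mono) auto
        then have "(m + 1) ^ N + n * (n + 1) ^ N \<le> Suc n * (n + 1) ^ N" by simp
        also have "\<dots> \<le> Suc n * (Suc n + 1) ^ N" by (intro mult_left_mono power_mono) auto
        finally show ?thesis .
      qed
      ultimately have "?c x \<otimes> v \<in> word_ball ?B (Suc n * (Suc n + 1) ^ N)"
        using word_ball_mono[OF subset_refl] by blast
      moreover have "w = inv (t [^] m) \<otimes> (?c x \<otimes> v)"
        using w w'_eq tc vc \<open>x \<in> carrier G\<close> by (simp add: m_assoc mult_inv_cancel_left)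
      ultimately show ?thesis
        using m t by (intro bexI[of _ t] exI[of _ m]) auto
    qed
  qed
qed

lemma polynomial_growth_eliminate:
  assumes "finite A" and A: "A \<subseteq> carrier G" and s: "s \<in> carrier G"
    and nil: "\<And>t a i. t \<in> carrier G \<Longrightarrow> a \<in> carrier G \<Longrightarrow> N \<le> i \<Longrightarrow> (commutator_with t ^^ i) a = \<one>"
    and B: "polynomial_growth (eliminate N s A)"
  shows "polynomial_growth A"
proof -
  let ?B = "eliminate N s A"
  obtain C d where Cd: "\<And>n. card (word_ball ?B n) \<le> C * (n + 1) ^ d"
    using B unfolding polynomial_growth_def by blast
  have "finite ?B" using \<open>finite A\<close> by (simp add: eliminate_def)
  have "card (word_ball A n) \<le> (2 * C) * (n + 1) ^ (Suc (Suc N * d))" for n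
  proof -
    let ?r = "n * (n + 1) ^ N"
    let ?f = "\<lambda>((t, m), v). inv (t [^] m) \<otimes> v"
    let ?D = "({s, inv s} \<times> {..n}) \<times> word_ball ?B ?r"
    have fin: "finite ?D" using finite_word_ball[OF \<open>finite ?B\<close>] by simp
    have "word_ball A n \<subseteq> ?f ` ?D"
    proof
      fix w assume "w \<in> word_ball A n"
      then show "w \<in> ?f ` ?D"
        using word_ball_eliminate[OF A s nil] by (fastforce simp: image_iff)
    qed
    then have "card (word_ball A n) \<le> card ?D"
      using fin by (meson card_image_le card_mono finite_imageI le_trans)
    also have "\<dots> \<le> 2 * (n + 1) * (C * (?r + 1) ^ d)"
      unfolding card_cartesian_product
      by (intro mult_mono Cd) (auto simp: card_insert_if)
    also have "\<dots> \<le> 2 * (n + 1) * (C * ((n + 1) ^ Suc N) ^ d)"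
      by (intro mult_left_mono power_mono) (auto simp: algebra_simps)
    also have "\<dots> = (2 * C) * (n + 1) ^ (Suc (Suc N * d))"
      unfolding power_mult[symmetric] power_Suc[of "n + 1" "Suc N * d"] by (simp only: mult_ac)
    finally show ?thesis .
  qed
  then show ?thesis unfolding polynomial_growth_def by blast
qed

text \<open>Letters are eliminated in the order of the lower central series: removing a letter of
  \<open>\<gamma>\<^sub>k - \<gamma>\<^bsub>k+1\<^esub>\<close> adds only new letters in \<open>\<gamma>\<^bsub>k+1\<^esub>\<close>, so after finitely many steps all letters lie in
  \<open>\<gamma>\<^bsub>k+1\<^esub>\<close>, and the process ends in the trivial group.\<close>
lemma nilpotent_polynomial_growth:
  assumes "nilpotent_group G" and "finite S" and "S \<subseteq> carrier G"
  shows "polynomial_growth S"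
proof -
  obtain N where N: "lower_central G N = {\<one>}"
    using assms(1) unfolding nilpotent_group_def by blast
  have nil: "(commutator_with t ^^ i) a = \<one>" if "t \<in> carrier G" "a \<in> carrier G" "N \<le> i" for t a i
    using commutator_with_iter_lower_central[OF that(1), of a 0 i] that
      lower_central_antimono[OF that(3)] N by auto
  have "polynomial_growth A" if "finite A" "A \<subseteq> lower_central G k" "k \<le> N" for A k
    using that(3,1,2)
  proof (induction k arbitrary: A rule: inc_induct)
    case base
    then have "A \<subseteq> {\<one>}" using N by simp
    then have "A \<union> m_inv G ` A \<subseteq> {\<one>}" by auto
    then have w: "wprod xs = \<one>" if "set xs \<subseteq> A \<union> m_inv G ` A" for xs
      using that by (induction xs) auto
    then have "word_ball A n \<subseteq> {\<one>}" for n
      unfolding word_ball_def by auto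
    then have "card (word_ball A n) \<le> 1" for n
      by (metis card_mono finite.emptyI finite_insert card.empty card_insert_disjoint empty_iff One_nat_def)
    then show ?case unfolding polynomial_growth_def by (intro exI[of _ 1] exI[of _ 0]) simp
  next
    case (step k)
    let ?L = "lower_central G (Suc k)"
    show ?case
      using step.prems
    proof (induction "card (A - ?L)" arbitrary: A rule: less_induct)
      case less
      show ?case
      proof (cases "A \<subseteq> ?L")
        case True
        then show ?thesis using step.IH less.prems by blast
      next
        case False
        then obtain s where s: "s \<in> A" "s \<notin> ?L" by blast
        let ?B = "eliminate N s A"
        have Ac: "A \<subseteq> carrier G" using less.prems lower_central_closed by blast
        have iter: "(commutator_with t ^^ i) a \<in> lower_central G (k + i)"
          if "t \<in> {s, inv s}" "a \<in> A" for t a i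
          using that s Ac less.prems by (intro commutator_with_iter_lower_central) auto
        have "?B \<subseteq> lower_central G k"
        proof
          fix b assume "b \<in> ?B"
          then obtain t i a where tia: "t \<in> {s, inv s}" "a \<in> A" "b = (commutator_with t ^^ i) a"
            unfolding eliminate_def by blast
          then show "b \<in> lower_central G k"
            using iter[of t a i] lower_central_antimono[of k "k + i"] by auto
        qed
        moreover have "finite ?B" using less.prems by (simp add: eliminate_def)
        moreover have "?B - ?L \<subseteq> (A - ?L) - {s}"
        proof
          fix b assume b: "b \<in> ?B - ?L"
          then obtain t i a where tia: "t \<in> {s, inv s}" "a \<in> A - {s}" "b = (commutator_with t ^^ i) a"
            unfolding eliminate_def by blast
          have "i = 0"
          proof (rule ccontr)
            assume "i \<noteq> 0"
            then have "lower_central G (k + i) \<subseteq> ?L" by (intro lower_central_antimono) simp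
            then show False using iter[of t a i] tia b by blast
          qed
          then show "b \<in> (A - ?L) - {s}" using tia b by simp
        qed
        then have "card (?B - ?L) < card (A - ?L)"
          using s less.prems by (intro psubset_card_mono) auto
        ultimately have "polynomial_growth ?B" using less.hyps by blast
        then show ?thesis
          using polynomial_growth_eliminate[OF less.prems(1) Ac _ nil] s Ac by blast
      qed
    qed
  qed
  then show ?thesis using assms by (metis lower_central.simps(1) le0)
qed

end

lemma summable_polynomial_times_exponential:
  assumes "0 < \<epsilon>"
  shows "summable (\<lambda>n. (real n + 1) ^ d * exp (- \<epsilon> * real n))"
proof (rule summable_comparison_test_bigo)
  show "summable (\<lambda>n. norm (exp (- (\<epsilon> / 2)) ^ n))"
    using assms by simp
  have "(\<lambda>x::real. (x + 1) powr real d * exp (- \<epsilon> * x)) \<in> O(\<lambda>x. exp (- (\<epsilon> / 2) * x))"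
    using assms by real_asymp
  then have "(\<lambda>n::nat. (real n + 1) powr real d * exp (- \<epsilon> * real n)) \<in> O(\<lambda>n. exp (- (\<epsilon> / 2) * real n))"
    by (rule landau_o.big.compose) (rule filterlim_real_sequentially)
  then show "(\<lambda>n::nat. (real n + 1) ^ d * exp (- \<epsilon> * real n)) \<in> O(\<lambda>n. exp (- (\<epsilon> / 2)) ^ n)"
    by (simp add: powr_realpow mult.commute flip: exp_of_nat_mult)
qed

context group
begin

text \<open>The number of elements of length \<open>n\<close> is at most polynomial in \<open>n\<close>.  The word balls cover each sphere, so the
  sum over spheres may be bounded by a sum over balls.\<close>
lemma exp_word_length_summable:
  assumes S: "S \<subseteq> carrier G" "generate G S = carrier G" "finite S" and growth: "polynomial_growth S" and "0 < \<epsilon>"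
  shows "(\<integral>\<^sup>+ g. ennreal (exp (- (\<epsilon> * real (word_length G S g)))) \<partial>count_space (carrier G)) < \<infinity>"
proof -
  obtain C d where Cd: "\<And>n. card (word_ball S n) \<le> C * (n + 1) ^ d"
    using growth unfolding polynomial_growth_def by blast
  let ?e = "\<lambda>n::nat. ennreal (exp (- \<epsilon> * real n))"
  let ?c = "\<lambda>n::nat. real C * ((real n + 1) ^ d * exp (- \<epsilon> * real n))"
  have "(\<integral>\<^sup>+ g. ennreal (exp (- (\<epsilon> * real (word_length G S g)))) \<partial>count_space (carrier G))
     \<le> (\<integral>\<^sup>+ g. (\<Sum>n. ?e n * indicator (word_ball S n) g) \<partial>count_space (carrier G))"
  proof (rule nn_integral_mono)
    fix g assume "g \<in> space (count_space (carrier G))"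
    then have "g \<in> word_ball S (word_length G S g)"
      using generate_imp_word_ball[OF S(1)] S(2) in_word_ball_word_length by fastforce
    then have "ennreal (exp (- (\<epsilon> * real (word_length G S g))))
      = (\<Sum>n\<in>{word_length G S g}. ?e n * indicator (word_ball S n) g)"
      by simp
    also have "\<dots> \<le> (\<Sum>n. ?e n * indicator (word_ball S n) g)"
      by (rule sum_le_suminf) auto
    finally show "ennreal (exp (- (\<epsilon> * real (word_length G S g))))
      \<le> (\<Sum>n. ?e n * indicator (word_ball S n) g)" .
  qed
  also have "\<dots> = (\<Sum>n. ?e n * of_nat (card (word_ball S n)))"
    using finite_word_ball[OF S(3)] word_ball_closed[OF S(1)]
    by (subst nn_integral_suminf) (auto simp: nn_integral_cmult emeasure_count_space_finite)
  also have "\<dots> \<le> (\<Sum>n. ennreal (?c n))"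
  proof (intro suminf_le summableI)
    fix n
    have "real (card (word_ball S n)) \<le> real C * (real n + 1) ^ d"
      using Cd[of n] by (simp flip: of_nat_Suc of_nat_power of_nat_mult add: add.commute)
    then have "exp (- \<epsilon> * real n) * real (card (word_ball S n)) \<le> ?c n"
      by (simp add: mult.commute mult.left_commute mult_left_mono)
    then show "?e n * of_nat (card (word_ball S n)) \<le> ennreal (?c n)"
      using ennreal_leI[of "exp (- \<epsilon> * real n) * real (card (word_ball S n))" "?c n"]
      by (simp only: ennreal_mult ennreal_of_nat_eq_real_of_nat exp_ge_zero of_nat_0_le_iff)
  qed
  also have "\<dots> = ennreal (\<Sum>n. ?c n)"
    using summable_polynomial_times_exponential[OF \<open>0 < \<epsilon>\<close>]
    by (intro suminf_ennreal2 summable_mult) auto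
  finally show ?thesis by (simp add: order_le_less_trans)
qed

lemma countable_carrier:
  assumes "S \<subseteq> carrier G" "generate G S = carrier G" "finite S"
  shows "countable (carrier G)"
proof -
  have "carrier G \<subseteq> (\<Union>n. word_ball S n)"
    using generate_imp_word_ball[OF assms(1)] assms(2) by auto
  moreover have "countable (\<Union>n. word_ball S n)"
    using finite_word_ball[OF assms(3)] by (intro countable_UN) (auto intro: countable_finite)
  ultimately show ?thesis by (rule countable_subset)
qed

end

section \<open>Entropy of convolutions\<close>

lemma convolution_pmf_eq_bind:
  "convolution_pmf G p q = bind_pmf p (\<lambda>x. translate_pmf G x q)"
  by (simp add: convolution_pmf_def translate_pmf_def pair_pmf_def map_bind_pmf map_pmf_def
      bind_assoc_pmf bind_return_pmf)

lemma pmf_tv_convolution_right_le: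
  "pmf_tv (convolution_pmf G p r) (convolution_pmf G q r) \<le> pmf_tv p q"
  unfolding convolution_pmf_eq_bind by (rule pmf_tv_bind_le)

lemma pmf_tv_translate_le: "pmf_tv (translate_pmf G g p) (translate_pmf G g q) \<le> pmf_tv p q"
  unfolding translate_pmf_def by (rule pmf_tv_map_le)

lemma set_pmf_translate: "set_pmf (translate_pmf G g p) = (\<lambda>x. g \<otimes>\<^bsub>G\<^esub> x) ` set_pmf p"
  by (simp add: translate_pmf_def)

lemma set_pmf_convolution:
  "set_pmf (convolution_pmf G p q) = (\<Union>x\<in>set_pmf p. (\<lambda>y. x \<otimes>\<^bsub>G\<^esub> y) ` set_pmf q)"
  by (simp add: convolution_pmf_eq_bind set_pmf_translate)

context group
begin

lemma set_pmf_convolution_carrier: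
  "set_pmf p \<subseteq> carrier G \<Longrightarrow> set_pmf q \<subseteq> carrier G \<Longrightarrow> set_pmf (convolution_pmf G p q) \<subseteq> carrier G"
  by (auto simp: set_pmf_convolution)

lemma translate_pmf_translate:
  assumes "g \<in> carrier G" "h \<in> carrier G" "set_pmf p \<subseteq> carrier G"
  shows "translate_pmf G g (translate_pmf G h p) = translate_pmf G (g \<otimes> h) p"
  unfolding translate_pmf_def map_pmf_comp
  using assms by (intro map_pmf_cong) (auto simp: m_assoc)

lemma translate_pmf_one: "set_pmf p \<subseteq> carrier G \<Longrightarrow> translate_pmf G \<one> p = p"
  unfolding translate_pmf_def
  using map_pmf_cong[OF refl, of p "\<lambda>x. \<one> \<otimes> x" "\<lambda>x. x"] by (auto simp: subset_iff)

lemma translate_pmf_convolution: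
  assumes "g \<in> carrier G" "set_pmf p \<subseteq> carrier G" "set_pmf q \<subseteq> carrier G"
  shows "translate_pmf G g (convolution_pmf G p q) = convolution_pmf G (translate_pmf G g p) q"
proof -
  have "translate_pmf G g (convolution_pmf G p q)
      = bind_pmf p (\<lambda>x. translate_pmf G g (translate_pmf G x q))"
    by (simp add: convolution_pmf_eq_bind translate_pmf_def map_bind_pmf)
  also have "\<dots> = bind_pmf p (\<lambda>x. translate_pmf G (g \<otimes> x) q)"
    using assms by (intro bind_pmf_cong) (auto simp: translate_pmf_translate)
  also have "\<dots> = convolution_pmf G (translate_pmf G g p) q"
    by (simp add: convolution_pmf_eq_bind translate_pmf_def bind_map_pmf)
  finally show ?thesis .
qed

lemma convolution_pmf_assoc:
  assumes "set_pmf p \<subseteq> carrier G" "set_pmf q \<subseteq> carrier G" "set_pmf r \<subseteq> carrier G"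
  shows "convolution_pmf G (convolution_pmf G p q) r = convolution_pmf G p (convolution_pmf G q r)"
proof -
  have "convolution_pmf G (convolution_pmf G p q) r
      = bind_pmf p (\<lambda>x. convolution_pmf G (translate_pmf G x q) r)"
    by (simp add: convolution_pmf_eq_bind bind_assoc_pmf)
  also have "\<dots> = bind_pmf p (\<lambda>x. translate_pmf G x (convolution_pmf G q r))"
    using assms by (intro bind_pmf_cong) (auto simp: translate_pmf_convolution)
  also have "\<dots> = convolution_pmf G p (convolution_pmf G q r)"
    by (simp add: convolution_pmf_eq_bind)
  finally show ?thesis .
qed

lemma pmf_translate:
  assumes "g \<in> carrier G" "y \<in> carrier G" "set_pmf p \<subseteq> carrier G"
  shows "pmf (translate_pmf G g p) y = pmf p (inv g \<otimes> y)"
proof (cases "inv g \<otimes> y \<in> set_pmf p")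
  case True
  have "inj_on (\<lambda>x. g \<otimes> x) (set_pmf p)"
    using assms by (auto intro!: inj_onI simp: subset_iff)
  from pmf_map_inj[OF this True] show ?thesis
    using assms by (simp add: translate_pmf_def mult_inv_cancel_left)
next
  case False
  then have "y \<notin> set_pmf (translate_pmf G g p)"
    using assms by (auto simp: set_pmf_translate mult_inv_cancel_left subset_iff)
  with False show ?thesis by (simp add: set_pmf_iff)
qed

lemma pmf_entropy_translate:
  assumes "g \<in> carrier G" "set_pmf p \<subseteq> carrier G"
  shows "pmf_entropy (translate_pmf G g p) = pmf_entropy p"
  unfolding translate_pmf_def
  using assms by (intro pmf_entropy_map_inj) (auto intro!: inj_onI simp: subset_iff)

text \<open>The cross entropy of \<open>z \<nu>\<close> with respect to \<open>\<alpha> \<nu>\<close>, averaged over \<open>z\<close> with law \<open>\<alpha>\<close>, is the entropy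
  of \<open>\<alpha> \<nu>\<close>, while each \<open>z \<nu>\<close> has the entropy of \<open>\<nu>\<close>.  Gibbs' inequality is applied to each \<open>z\<close>, and only
  the term \<open>z = x\<close> of the averaged gain is kept.\<close>
lemma pmf_entropy_convolution:
  assumes \<alpha>: "set_pmf \<alpha> \<subseteq> carrier G" and \<nu>: "set_pmf \<nu> \<subseteq> carrier G" and x: "x \<in> set_pmf \<alpha>"
  shows "pmf_entropy \<nu> + ennreal (pmf \<alpha> x * (pmf_tv (translate_pmf G x \<nu>) (convolution_pmf G \<alpha> \<nu>))\<^sup>2 / 4)
         \<le> pmf_entropy (convolution_pmf G \<alpha> \<nu>)"
proof -
  let ?q = "convolution_pmf G \<alpha> \<nu>"
  let ?t = "\<lambda>z. ennreal ((pmf_tv (translate_pmf G z \<nu>) ?q)\<^sup>2 / 4)"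
  have "pmf_entropy \<nu> + ennreal (pmf \<alpha> x * (pmf_tv (translate_pmf G x \<nu>) ?q)\<^sup>2 / 4)
      = pmf_entropy \<nu> + (\<integral>\<^sup>+ z. ?t z * indicator {x} z \<partial>measure_pmf \<alpha>)"
  proof -
    have "(\<integral>\<^sup>+ z. ?t z * indicator {x} z \<partial>measure_pmf \<alpha>) = (\<integral>\<^sup>+ z. ?t x * indicator {x} z \<partial>measure_pmf \<alpha>)"
      by (intro nn_integral_cong) (simp split: split_indicator)
    also have "\<dots> = ?t x * ennreal (pmf \<alpha> x)"
      by (simp add: nn_integral_cmult_indicator emeasure_pmf_single)
    also have "\<dots> = ennreal (pmf \<alpha> x * (pmf_tv (translate_pmf G x \<nu>) ?q)\<^sup>2 / 4)"
      by (simp add: mult.commute flip: ennreal_mult)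
    finally show ?thesis by simp
  qed
  also have "\<dots> \<le> pmf_entropy \<nu> + (\<integral>\<^sup>+ z. ?t z \<partial>measure_pmf \<alpha>)"
    by (intro add_left_mono nn_integral_mono) (auto split: split_indicator)
  also have "\<dots> = (\<integral>\<^sup>+ z. pmf_entropy \<nu> + ?t z \<partial>measure_pmf \<alpha>)"
    by (simp add: nn_integral_add)
  also have "\<dots> \<le> (\<integral>\<^sup>+ z. (\<integral>\<^sup>+ y. ennreal (- ln (pmf ?q y)) \<partial>measure_pmf (translate_pmf G z \<nu>)) \<partial>measure_pmf \<alpha>)"
  proof (rule nn_integral_mono_AE, rule AE_pmfI)
    fix z assume z: "z \<in> set_pmf \<alpha>"
    then have "set_pmf (translate_pmf G z \<nu>) \<subseteq> set_pmf ?q"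
      by (auto simp: set_pmf_translate set_pmf_convolution)
    from gibbs_inequality_tv[OF this] show "pmf_entropy \<nu> + ?t z
      \<le> (\<integral>\<^sup>+ y. ennreal (- ln (pmf ?q y)) \<partial>measure_pmf (translate_pmf G z \<nu>))"
      using z \<alpha> \<nu> by (simp add: pmf_entropy_translate subset_iff)
  qed
  also have "\<dots> = pmf_entropy ?q"
  proof -
    have "(\<integral>\<^sup>+ y. f y \<partial>measure_pmf ?q)
        = (\<integral>\<^sup>+ z. (\<integral>\<^sup>+ y. f y \<partial>measure_pmf (translate_pmf G z \<nu>)) \<partial>measure_pmf \<alpha>)" for f :: "'a \<Rightarrow> ennreal"
      by (simp add: convolution_pmf_eq_bind)
    then show ?thesis by (simp only: pmf_entropy_def)
  qed
  finally show ?thesis .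
qed

end

section \<open>Random walks driven by a measure preserving transformation\<close>

lemma measurable_funpow:
  "T \<in> measurable M M \<Longrightarrow> T ^^ n \<in> measurable M M"
proof (induction n)
  case (Suc n)
  then show ?case unfolding funpow.simps by (intro measurable_comp)
qed simp

lemma distr_funpow:
  assumes T: "T \<in> measurable M M" and "distr M M T = M"
  shows "distr M M (T ^^ n) = M"
proof (induction n)
  case 0
  show ?case by (simp add: distr_id[unfolded id_def] id_def)
next
  case (Suc n)
  have "distr M M (T ^^ Suc n) = distr (distr M M (T ^^ n)) M T"
    using T measurable_funpow[OF T] by (simp add: distr_distr)
  also have "\<dots> = M" using Suc assms by simp
  finally show ?case .
qed

lemma measurable_pmf_value:
  assumes "(\<lambda>\<omega>. measure_pmf (P \<omega>)) \<in> measurable M (prob_algebra (count_space UNIV))"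
  shows "(\<lambda>\<omega>. pmf (P \<omega>) x) \<in> borel_measurable M"
proof -
  have "(\<lambda>\<omega>. emeasure (measure_pmf (P \<omega>)) {x}) \<in> borel_measurable M"
    by (rule measurable_compose[OF measurable_prob_algebraD[OF assms] measurable_emeasure_subprob_algebra])
       simp
  then have "(\<lambda>\<omega>. enn2real (emeasure (measure_pmf (P \<omega>)) {x})) \<in> borel_measurable M"
    by simp
  then show ?thesis by (simp add: emeasure_pmf_single)
qed

text \<open>A countable index set makes the counting measure \<open>\<sigma>\<close>-finite, so this is measurability of a parameter
  integral.  Sums over a finitely generated group are of this form even if its type is uncountable.\<close>
lemma measurable_nn_integral_count_space:
  assumes "countable A" and "\<And>x. x \<in> A \<Longrightarrow> f x \<in> borel_measurable M"
  shows "(\<lambda>\<omega>. \<integral>\<^sup>+ x. f x \<omega> \<partial>count_space A) \<in> borel_measurable M"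
proof -
  interpret sigma_finite_measure "count_space A"
    using assms(1) by (rule sigma_finite_measure_count_space_countable)
  have "(\<lambda>(x, \<omega>). f x \<omega>) \<in> borel_measurable (count_space A \<Otimes>\<^sub>M M)"
    using assms by (intro measurable_pair_measure_countable1) auto
  then have "(\<lambda>(\<omega>, x). f x \<omega>) \<in> borel_measurable (M \<Otimes>\<^sub>M count_space A)"
    by (subst (asm) measurable_pair_swap_iff) (simp add: split_beta')
  then show ?thesis
    by (intro borel_measurable_nn_integral) simp
qed

lemma nn_integral_measure_pmf_carrier:
  assumes "set_pmf p \<subseteq> A"
  shows "(\<integral>\<^sup>+ x. f x \<partial>measure_pmf p) = (\<integral>\<^sup>+ x. ennreal (pmf p x) * f x \<partial>count_space A)"
proof -
  have "(\<integral>\<^sup>+ x. ennreal (pmf p x) * f x \<partial>count_space UNIV)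
      = (\<integral>\<^sup>+ x. ennreal (pmf p x) * f x * indicator A x \<partial>count_space UNIV)"
    using assms by (intro nn_integral_cong) (auto simp: set_pmf_iff split: split_indicator)
  then show ?thesis
    by (simp add: nn_integral_measure_pmf nn_integral_count_space_indicator)
qed

definition mean_length :: "('a \<Rightarrow> nat) \<Rightarrow> 'a pmf \<Rightarrow> ennreal" where
  "mean_length l p = (\<integral>\<^sup>+ x. ennreal (real (l x)) \<partial>measure_pmf p)"

locale random_walk_cocycle = group G for G (structure) +
  fixes M :: "'w measure" and T :: "'w \<Rightarrow> 'w" and \<mu> :: "'w \<Rightarrow> 'a pmf"
  assumes countable: "countable (carrier G)"
    and T: "T \<in> measurable M M" and mpt: "distr M M T = M"
    and prob: "prob_space M"
    and supp: "\<omega> \<in> space M \<Longrightarrow> set_pmf (\<mu> \<omega>) \<subseteq> carrier G"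
    and meas: "(\<lambda>\<omega>. measure_pmf (\<mu> \<omega>)) \<in> measurable M (prob_algebra (count_space UNIV))"
begin

lemma T_space: "\<omega> \<in> space M \<Longrightarrow> (T ^^ n) \<omega> \<in> space M"
  by (rule measurable_space[OF measurable_funpow[OF T]])

lemma nn_integral_T:
  assumes "f \<in> borel_measurable M"
  shows "(\<integral>\<^sup>+ \<omega>. f ((T ^^ n) \<omega>) \<partial>M) = (\<integral>\<^sup>+ \<omega>. f \<omega> \<partial>M)"
proof -
  have "(\<integral>\<^sup>+ \<omega>. f ((T ^^ n) \<omega>) \<partial>M) = (\<integral>\<^sup>+ \<omega>. f \<omega> \<partial>distr M M (T ^^ n))"
    using assms by (intro nn_integral_distr[symmetric] measurable_funpow T) auto
  then show ?thesis by (simp only: distr_funpow[OF T mpt])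
qed

lemma set_pmf_mu0: "\<omega> \<in> space M \<Longrightarrow> set_pmf (mu0 G T \<mu> \<omega> n) \<subseteq> carrier G"
proof (induction n)
  case (Suc n)
  then show ?case
    unfolding mu0.simps by (intro set_pmf_convolution_carrier supp T_space)
qed (simp add: supp)

lemma mu0_add:
  assumes "\<omega> \<in> space M"
  shows "mu0 G T \<mu> \<omega> (n + Suc k) = convolution_pmf G (mu0 G T \<mu> \<omega> k) (mu0 G T \<mu> ((T ^^ Suc k) \<omega>) n)"
proof (induction n)
  case 0
  show ?case by simp
next
  case (Suc n)
  have "(T ^^ Suc n) ((T ^^ Suc k) \<omega>) = (T ^^ Suc (n + Suc k)) \<omega>"
    by (simp only: funpow_add comp_apply add_Suc[symmetric])
  then show ?case
    using assms Suc
    by (simp add: convolution_pmf_assoc set_pmf_mu0 supp T_space del: funpow.simps)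
qed

lemma measurable_pmf_mu0:
  "y \<in> carrier G \<Longrightarrow> (\<lambda>\<omega>. pmf (mu0 G T \<mu> \<omega> n) y) \<in> borel_measurable M"
proof (induction n arbitrary: y)
  case 0
  show ?case by (simp add: measurable_pmf_value[OF meas])
next
  case (Suc n)
  let ?f = "\<lambda>\<omega>. \<integral>\<^sup>+ x. ennreal (pmf (mu0 G T \<mu> \<omega> n) x) *
      ennreal (pmf (\<mu> ((T ^^ Suc n) \<omega>)) (inv x \<otimes> y)) \<partial>count_space (carrier G)"
  have \<mu>: "(\<lambda>\<omega>. pmf (\<mu> ((T ^^ Suc n) \<omega>)) z) \<in> borel_measurable M" for z
    using measurable_compose[OF measurable_funpow[OF T] measurable_pmf_value[OF meas]] .
  have "?f \<in> borel_measurable M"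
    by (intro Suc.IH \<mu> measurable_nn_integral_count_space countable borel_measurable_times_ennreal measurable_compose[OF _ measurable_ennreal])
  moreover have "ennreal (pmf (mu0 G T \<mu> \<omega> (Suc n)) y) = ?f \<omega>" if "\<omega> \<in> space M" for \<omega>
    using that Suc.prems
    by (auto simp add: convolution_pmf_eq_bind ennreal_pmf_bind supp T_space pmf_translate
        nn_integral_measure_pmf_carrier[OF set_pmf_mu0] simp del: funpow.simps intro!: nn_integral_cong)
  ultimately have "(\<lambda>\<omega>. ennreal (pmf (mu0 G T \<mu> \<omega> (Suc n)) y)) \<in> borel_measurable M"
    by (subst measurable_cong)
  then have "(\<lambda>\<omega>. enn2real (ennreal (pmf (mu0 G T \<mu> \<omega> (Suc n)) y))) \<in> borel_measurable M"
    by (rule measurable_compose) simp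
  then show ?case by simp
qed

lemma measurable_entropy_mu0: "(\<lambda>\<omega>. pmf_entropy (mu0 G T \<mu> \<omega> n)) \<in> borel_measurable M"
proof -
  let ?f = "\<lambda>\<omega>. \<integral>\<^sup>+ x. ennreal (pmf (mu0 G T \<mu> \<omega> n) x) *
      ennreal (- ln (pmf (mu0 G T \<mu> \<omega> n) x)) \<partial>count_space (carrier G)"
  have "?f \<in> borel_measurable M"
    by (intro measurable_nn_integral_count_space countable borel_measurable_times_ennreal
        measurable_compose[OF _ measurable_ennreal] borel_measurable_uminus
        borel_measurable_ln measurable_pmf_mu0)
  moreover have "pmf_entropy (mu0 G T \<mu> \<omega> n) = ?f \<omega>" if "\<omega> \<in> space M" for \<omega>
    using that by (simp add: pmf_entropy_def nn_integral_measure_pmf_carrier[OF set_pmf_mu0])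
  ultimately show ?thesis by (subst measurable_cong)
qed

lemma measurable_mean_length: "(\<lambda>\<omega>. mean_length l (\<mu> \<omega>)) \<in> borel_measurable M"
proof -
  let ?f = "\<lambda>\<omega>. \<integral>\<^sup>+ x. ennreal (pmf (\<mu> \<omega>) x) * ennreal (real (l x)) \<partial>count_space (carrier G)"
  have "?f \<in> borel_measurable M"
    by (intro measurable_nn_integral_count_space countable borel_measurable_times_ennreal
        measurable_compose[OF _ measurable_ennreal] measurable_pmf_value[OF meas] measurable_const) auto
  moreover have "mean_length l (\<mu> \<omega>) = ?f \<omega>" if "\<omega> \<in> space M" for \<omega>
    using that by (simp add: mean_length_def nn_integral_measure_pmf_carrier[OF supp])
  ultimately show ?thesis by (subst measurable_cong)
qed

lemma mean_length_convolution:
  assumes "set_pmf p \<subseteq> carrier G" "set_pmf q \<subseteq> carrier G"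
    and l: "\<And>g h. g \<in> carrier G \<Longrightarrow> h \<in> carrier G \<Longrightarrow> l (g \<otimes> h) \<le> l g + l h"
  shows "mean_length l (convolution_pmf G p q) \<le> mean_length l p + mean_length l q"
proof -
  have "mean_length l (convolution_pmf G p q) = (\<integral>\<^sup>+ x. \<integral>\<^sup>+ y. ennreal (real (l (x \<otimes> y))) \<partial>measure_pmf q \<partial>measure_pmf p)"
    by (simp add: mean_length_def convolution_pmf_eq_bind translate_pmf_def)
  also have "\<dots> \<le> (\<integral>\<^sup>+ x. \<integral>\<^sup>+ y. ennreal (real (l x)) + ennreal (real (l y)) \<partial>measure_pmf q \<partial>measure_pmf p)"
    using assms
    by (intro nn_integral_mono_AE AE_pmfI) (auto simp: subset_iff ennreal_leI simp flip: ennreal_plus of_nat_add)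
  also have "\<dots> = mean_length l p + mean_length l q"
    by (simp add: nn_integral_add mean_length_def)
  finally show ?thesis .
qed

text \<open>The dominating function is the sum of the mean lengths of the increments; by invariance each of them has
  the same integral.\<close>
lemma integral_mean_length_mu0:
  assumes l: "\<And>g h. g \<in> carrier G \<Longrightarrow> h \<in> carrier G \<Longrightarrow> l (g \<otimes> h) \<le> l g + l h"
  shows "\<exists>f\<in>borel_measurable M. (\<forall>\<omega>\<in>space M. mean_length l (mu0 G T \<mu> \<omega> n) \<le> f \<omega>) \<and>
     (\<integral>\<^sup>+ \<omega>. f \<omega> \<partial>M) = of_nat (Suc n) * (\<integral>\<^sup>+ \<omega>. mean_length l (\<mu> \<omega>) \<partial>M)"
proof -
  let ?g = "\<lambda>\<omega>. mean_length l (\<mu> \<omega>)"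
  let ?f = "\<lambda>\<omega>. \<Sum>i<Suc n. ?g ((T ^^ i) \<omega>)"
  have g: "(\<lambda>\<omega>. ?g ((T ^^ i) \<omega>)) \<in> borel_measurable M" for i
    using measurable_compose[OF measurable_funpow[OF T] measurable_mean_length] .
  have "mean_length l (mu0 G T \<mu> \<omega> n) \<le> ?f \<omega>" if \<omega>: "\<omega> \<in> space M" for \<omega>
  proof (induction n)
    case 0
    show ?case by simp
  next
    case (Suc n)
    have "mean_length l (mu0 G T \<mu> \<omega> (Suc n)) \<le> mean_length l (mu0 G T \<mu> \<omega> n) + ?g ((T ^^ Suc n) \<omega>)"
      unfolding mu0.simps using \<omega> by (intro mean_length_convolution set_pmf_mu0 supp T_space l)
    also have "\<dots> \<le> (\<Sum>i<Suc n. ?g ((T ^^ i) \<omega>)) + ?g ((T ^^ Suc n) \<omega>)"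
      by (intro add_right_mono Suc)
    finally show ?case by (simp add: add.assoc del: funpow.simps)
  qed
  moreover have "(\<integral>\<^sup>+ \<omega>. ?f \<omega> \<partial>M) = of_nat (Suc n) * (\<integral>\<^sup>+ \<omega>. ?g \<omega> \<partial>M)"
    using g by (subst nn_integral_sum) (auto simp: nn_integral_T[OF measurable_mean_length] simp del: sum.lessThan_Suc)
  moreover have "?f \<in> borel_measurable M" using g by (intro borel_measurable_sum)
  ultimately show ?thesis by (intro bexI[of _ ?f] conjI ballI)
qed

end

section \<open>Vanishing of the entropy gain and left invariance\<close>

text \<open>If all increments were at least \<open>\<delta>\<close>, then \<open>a\<close> would grow along the multiples of \<open>K\<close> with slope
  \<open>\<delta> / K\<close>, which is twice the slope \<open>\<epsilon>\<close> chosen in the proof.\<close>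
lemma sublinear_imp_small_increment:
  fixes a :: "nat \<Rightarrow> real"
  assumes lin: "\<And>\<epsilon>. 0 < \<epsilon> \<Longrightarrow> \<exists>Z. \<forall>n. a n \<le> \<epsilon> * real n + Z"
    and "0 < \<delta>" and "0 < K"
  shows "\<exists>n. a (n + K) - a n < \<delta>"
proof (rule ccontr)
  assume "\<not> ?thesis"
  then have step: "a n + \<delta> \<le> a (n + K)" for n by (force simp: not_less algebra_simps)
  have lower: "a 0 + \<delta> * real j \<le> a (j * K)" for j
  proof (induction j)
    case (Suc j)
    then show ?case using step[of "j * K"] by (simp add: algebra_simps)
  qed simp
  define \<epsilon> where "\<epsilon> = \<delta> / (2 * real K)"
  have "0 < \<epsilon>" using assms by (simp add: \<epsilon>_def)
  then obtain Z where Z: "\<And>n. a n \<le> \<epsilon> * real n + Z" using lin by blast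
  have "a 0 + \<delta> * real j \<le> \<delta> / 2 * real j + Z" for j
  proof -
    have "\<epsilon> * real (j * K) = \<delta> / 2 * real j" using \<open>0 < K\<close> by (simp add: \<epsilon>_def)
    then show ?thesis using lower[of j] Z[of "j * K"] by linarith
  qed
  then have le: "\<delta> / 2 * real j \<le> Z - a 0" for j by (smt (verit) field_sum_of_halves distrib_right)
  obtain j where "Z - a 0 < real j * (\<delta> / 2)"
    using reals_Archimedean3[of "\<delta> / 2"] \<open>0 < \<delta>\<close> by (meson half_gt_zero)
  with le[of j] show False by (simp add: mult.commute)
qed

lemma pmf_tv_tendsto_0_dominated:
  assumes "\<And>n. pmf_tv (p n) (q n) \<le> f n" and "f \<longlonglongrightarrow> 0"
  shows "(\<lambda>n. pmf_tv (p n) (q n)) \<longlonglongrightarrow> 0"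
proof (rule Lim_null_comparison[OF always_eventually assms(2)])
  show "\<forall>n. norm (pmf_tv (p n) (q n)) \<le> f n"
    using assms(1) by (simp add: pmf_tv_nonneg)
qed

lemma not_mutually_singular_imp_common_point:
  assumes "\<not> mutually_singular (measure_pmf p) (measure_pmf q)"
  shows "\<exists>x. x \<in> set_pmf p \<and> x \<in> set_pmf q"
proof (rule ccontr)
  assume "\<not> ?thesis"
  then have "emeasure (measure_pmf p) (- set_pmf p) = 0" "emeasure (measure_pmf q) (UNIV - (- set_pmf p)) = 0"
    by (auto simp: measure_pmf.emeasure_eq_measure measure_pmf_zero_iff)
  then show False using assms unfolding mutually_singular_def by auto
qed

context random_walk_cocycle
begin

definition mean_entropy :: "nat \<Rightarrow> ennreal" where
  "mean_entropy n = (\<integral>\<^sup>+ \<omega>. pmf_entropy (mu0 G T \<mu> \<omega> n) \<partial>M)"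

text \<open>Gibbs' inequality with weight \<open>exp (- e l)\<close>, where \<open>e\<close> is so small that \<open>e\<close> times the first moment is at
  most \<open>\<epsilon>\<close>.\<close>
lemma mean_entropy_sublinear:
  assumes l: "\<And>g h. g \<in> carrier G \<Longrightarrow> h \<in> carrier G \<Longrightarrow> l (g \<otimes> h) \<le> l g + l h"
    and moment: "(\<integral>\<^sup>+ \<omega>. mean_length l (\<mu> \<omega>) \<partial>M) < \<infinity>"
    and growth: "\<And>\<epsilon>. 0 < \<epsilon> \<Longrightarrow> (\<integral>\<^sup>+ g. ennreal (exp (- (\<epsilon> * real (l g)))) \<partial>count_space (carrier G)) < \<infinity>"
    and "0 < \<epsilon>"
  shows "\<exists>Z. \<forall>n. mean_entropy n \<le> ennreal (\<epsilon> * real n + Z)"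
proof -
  obtain m where m: "0 \<le> m" "(\<integral>\<^sup>+ \<omega>. mean_length l (\<mu> \<omega>) \<partial>M) = ennreal m"
    using moment by (cases "\<integral>\<^sup>+ \<omega>. mean_length l (\<mu> \<omega>) \<partial>M") auto
  define e where "e = \<epsilon> / (m + 1)"
  have e: "0 < e" "e * m \<le> \<epsilon>"
    using m \<open>0 < \<epsilon>\<close> by (auto simp: e_def field_simps)
  obtain Z where Z: "0 \<le> Z" "(\<integral>\<^sup>+ g. ennreal (exp (- (e * real (l g)))) \<partial>count_space (carrier G)) = ennreal Z"
    using growth[OF e(1)] by (cases "\<integral>\<^sup>+ g. ennreal (exp (- (e * real (l g)))) \<partial>count_space (carrier G)") auto
  have "mean_entropy n \<le> ennreal (\<epsilon> * real n + (\<epsilon> + Z))" for n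
  proof -
    obtain f where f: "f \<in> borel_measurable M" "\<And>\<omega>. \<omega> \<in> space M \<Longrightarrow> mean_length l (mu0 G T \<mu> \<omega> n) \<le> f \<omega>"
      "(\<integral>\<^sup>+ \<omega>. f \<omega> \<partial>M) = of_nat (Suc n) * ennreal m"
      using integral_mean_length_mu0[OF l, of n] m(2) by auto
    have "mean_entropy n \<le> (\<integral>\<^sup>+ \<omega>. ennreal e * f \<omega> + ennreal Z \<partial>M)"
      unfolding mean_entropy_def
    proof (rule nn_integral_mono)
      fix \<omega> assume \<omega>: "\<omega> \<in> space M"
      have "pmf_entropy (mu0 G T \<mu> \<omega> n)
          \<le> (\<integral>\<^sup>+ x. ennreal (e * real (l x)) \<partial>measure_pmf (mu0 G T \<mu> \<omega> n)) + ennreal Z"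
        using pmf_entropy_le_exponential_weight[OF _ set_pmf_mu0[OF \<omega>], of "\<lambda>x. e * real (l x)"] e Z(2)
        by simp
      also have "(\<integral>\<^sup>+ x. ennreal (e * real (l x)) \<partial>measure_pmf (mu0 G T \<mu> \<omega> n))
          = ennreal e * mean_length l (mu0 G T \<mu> \<omega> n)"
        using e by (simp add: mean_length_def ennreal_mult nn_integral_cmult)
      also have "\<dots> \<le> ennreal e * f \<omega>"
        by (intro mult_left_mono f(2) \<omega>) simp
      finally show "pmf_entropy (mu0 G T \<mu> \<omega> n) \<le> ennreal e * f \<omega> + ennreal Z"
        by (simp add: add_right_mono)
    qed
    also have "\<dots> = ennreal e * (of_nat (Suc n) * ennreal m) + ennreal Z"
      using f prob_space.emeasure_space_1[OF prob]
      by (simp add: nn_integral_add nn_integral_cmult)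
    also have "\<dots> = ennreal (e * (real (Suc n) * m) + Z)"
      using e m(1) Z(1)
      by (simp only: ennreal_of_nat_eq_real_of_nat ennreal_mult ennreal_plus mult_nonneg_nonneg
          of_nat_0_le_iff less_imp_le)
    also have "\<dots> \<le> ennreal (\<epsilon> * real n + (\<epsilon> + Z))"
    proof (rule ennreal_leI)
      have "e * (real (Suc n) * m) = (e * m) * real (Suc n)" by simp
      also have "\<dots> \<le> \<epsilon> * real (Suc n)" using e(2) by (intro mult_right_mono) auto
      finally show "e * (real (Suc n) * m) + Z \<le> \<epsilon> * real n + (\<epsilon> + Z)" by (simp add: algebra_simps)
    qed
    finally show ?thesis .
  qed
  then show ?thesis by blast
qed

text \<open>The mutual information between the positions at times \<open>k + 1\<close> and \<open>n + k + 2\<close>; meaningful when the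
  subtracted entropy is finite.\<close>
definition entropy_gain :: "nat \<Rightarrow> nat \<Rightarrow> 'w \<Rightarrow> ennreal" where
  "entropy_gain k n \<omega> = pmf_entropy (mu0 G T \<mu> \<omega> (n + Suc k)) - pmf_entropy (mu0 G T \<mu> ((T ^^ Suc k) \<omega>) n)"

text \<open>The integral of the gain is an increment of the mean entropy, and increments of a sublinear sequence drop
  below every positive bound.  The infimum of the gains over \<open>n\<close> is at most each single gain, so its
  integral is at most each of these increments.\<close>
lemma AE_entropy_gain_vanishes:
  assumes lin: "\<And>\<epsilon>. 0 < \<epsilon> \<Longrightarrow> \<exists>Z. \<forall>n. mean_entropy n \<le> ennreal (\<epsilon> * real n + Z)"
  shows "AE \<omega> in M. (INF n. entropy_gain k n \<omega>) = 0 \<and> (\<forall>n. pmf_entropy (mu0 G T \<mu> ((T ^^ Suc k) \<omega>) n) < \<infinity>)"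
proof -
  let ?H = "\<lambda>n \<omega>. pmf_entropy (mu0 G T \<mu> \<omega> n)"
  let ?K = "Suc k"
  have meas: "(\<lambda>\<omega>. ?H n ((T ^^ ?K) \<omega>)) \<in> borel_measurable M" for n
    by (rule measurable_compose[OF measurable_funpow[OF T] measurable_entropy_mu0])
  have shift: "(\<integral>\<^sup>+ \<omega>. ?H n ((T ^^ ?K) \<omega>) \<partial>M) = mean_entropy n" for n
    unfolding mean_entropy_def by (rule nn_integral_T[OF measurable_entropy_mu0])
  have fin: "mean_entropy n < \<infinity>" for n
    using lin[of 1] by (auto intro: le_less_trans)
  have AE_fin: "AE \<omega> in M. \<forall>n. ?H n ((T ^^ ?K) \<omega>) < \<infinity>"
    unfolding AE_all_countable
  proof
    fix n
    have "(\<integral>\<^sup>+ \<omega>. ?H n ((T ^^ ?K) \<omega>) \<partial>M) \<noteq> \<infinity>"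
      unfolding shift using fin[of n] by simp
    from nn_integral_PInf_AE[OF meas this]
    show "AE \<omega> in M. ?H n ((T ^^ ?K) \<omega>) < \<infinity>"
      by eventually_elim (simp add: less_top)
  qed
  have mono: "?H n ((T ^^ ?K) \<omega>) \<le> ?H (n + ?K) \<omega>" if "\<omega> \<in> space M" for n \<omega>
  proof -
    obtain x where "x \<in> set_pmf (mu0 G T \<mu> \<omega> k)" using set_pmf_not_empty[of "mu0 G T \<mu> \<omega> k"] by blast
    from pmf_entropy_convolution[OF set_pmf_mu0 set_pmf_mu0 this, OF that T_space[OF that]]
    show ?thesis unfolding mu0_add[OF that] by (rule order_trans[rotated]) simp
  qed
  have meas_gain: "entropy_gain k n \<in> borel_measurable M" for n
    unfolding entropy_gain_def[abs_def]
    by (intro borel_measurable_minus_ennreal measurable_entropy_mu0 meas)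
  have gain: "(\<integral>\<^sup>+ \<omega>. entropy_gain k n \<omega> \<partial>M) = mean_entropy (n + ?K) - mean_entropy n" for n
    unfolding entropy_gain_def
    by (subst nn_integral_diff[OF measurable_entropy_mu0 meas])
       (use shift fin[of n] mono in \<open>auto simp: mean_entropy_def simp del: funpow.simps\<close>)
  have "(\<integral>\<^sup>+ \<omega>. (INF n. entropy_gain k n \<omega>) \<partial>M) = 0"
  proof (rule ccontr)
    assume "(\<integral>\<^sup>+ \<omega>. (INF n. entropy_gain k n \<omega>) \<partial>M) \<noteq> 0"
    then have "0 < (\<integral>\<^sup>+ \<omega>. (INF n. entropy_gain k n \<omega>) \<partial>M)" by (simp add: zero_less_iff_neq_zero)
    then obtain z where z: "0 < z" "z < (\<integral>\<^sup>+ \<omega>. (INF n. entropy_gain k n \<omega>) \<partial>M)"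
      using dense by blast
    then obtain \<delta> where \<delta>: "0 < \<delta>" "ennreal \<delta> < (\<integral>\<^sup>+ \<omega>. (INF n. entropy_gain k n \<omega>) \<partial>M)"
      by (cases z) auto
    have "\<exists>n. enn2real (mean_entropy (n + ?K)) - enn2real (mean_entropy n) < \<delta>"
    proof (rule sublinear_imp_small_increment)
      fix \<epsilon> :: real assume "0 < \<epsilon>"
      then obtain Z where Z: "\<And>n. mean_entropy n \<le> ennreal (\<epsilon> * real n + Z)" using lin by blast
      have "enn2real (mean_entropy n) \<le> \<epsilon> * real n + \<bar>Z\<bar>" for n
        using Z[of n] \<open>0 < \<epsilon>\<close>
        by (intro enn2real_leI order_trans[OF Z] ennreal_leI) auto
      then show "\<exists>Z. \<forall>n. enn2real (mean_entropy n) \<le> \<epsilon> * real n + Z" by blast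
    qed (use \<delta> in auto)
    then obtain n where n: "enn2real (mean_entropy (n + ?K)) - enn2real (mean_entropy n) < \<delta>" by blast
    have "(\<integral>\<^sup>+ \<omega>. (INF n. entropy_gain k n \<omega>) \<partial>M) \<le> (\<integral>\<^sup>+ \<omega>. entropy_gain k n \<omega> \<partial>M)"
      by (intro nn_integral_mono INF_lower UNIV_I)
    also have "\<dots> = ennreal (enn2real (mean_entropy (n + ?K)) - enn2real (mean_entropy n))"
      unfolding gain using fin by (subst ennreal_minus[symmetric]) (simp_all add: ennreal_enn2real)
    also have "\<dots> \<le> ennreal \<delta>" using n by (intro ennreal_leI) simp
    finally show False using \<delta>(2) by simp
  qed
  then have "AE \<omega> in M. (INF n. entropy_gain k n \<omega>) = 0"
    using meas_gain by (subst (asm) nn_integral_0_iff_AE) (auto intro!: borel_measurable_INF)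
  with AE_fin show ?thesis by eventually_elim simp
qed

text \<open>The gain dominates the squared distance times a positive multiple of the mass of \<open>x\<close>, so the distance is small for
  some \<open>n\<close>; both measures are convolved on the right with the same increments, so it stays small.\<close>
lemma tv_translate_vanishes:
  assumes \<omega>: "\<omega> \<in> space M" and x: "x \<in> set_pmf (mu0 G T \<mu> \<omega> k)"
    and gain: "(INF n. entropy_gain k n \<omega>) = 0"
    and fin: "\<And>n. pmf_entropy (mu0 G T \<mu> ((T ^^ Suc k) \<omega>) n) < \<infinity>"
  shows "(\<lambda>n. pmf_tv (translate_pmf G x (mu0 G T \<mu> ((T ^^ Suc k) \<omega>) n)) (mu0 G T \<mu> \<omega> (n + Suc k))) \<longlonglongrightarrow> 0"
proof -
  let ?\<nu> = "mu0 G T \<mu> ((T ^^ Suc k) \<omega>)"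
  define t where "t n = pmf_tv (translate_pmf G x (?\<nu> n)) (mu0 G T \<mu> \<omega> (n + Suc k))" for n
  have xc: "x \<in> carrier G" using x set_pmf_mu0[OF \<omega>] by blast
  have x0: "0 < pmf (mu0 G T \<mu> \<omega> k) x" using x by (simp add: pmf_positive)
  have t0: "0 \<le> t n" for n by (simp add: t_def pmf_tv_nonneg)
  have anti: "t (Suc n) \<le> t n" for n
  proof -
    have "(T ^^ Suc n) ((T ^^ Suc k) \<omega>) = (T ^^ Suc (n + Suc k)) \<omega>"
      by (simp only: funpow_add comp_apply add_Suc[symmetric])
    then have "t (Suc n) = pmf_tv (convolution_pmf G (translate_pmf G x (?\<nu> n)) (\<mu> ((T ^^ Suc (n + Suc k)) \<omega>)))
      (convolution_pmf G (mu0 G T \<mu> \<omega> (n + Suc k)) (\<mu> ((T ^^ Suc (n + Suc k)) \<omega>)))"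
      by (simp add: t_def translate_pmf_convolution xc set_pmf_mu0 T_space \<omega> supp del: funpow.simps)
    also have "\<dots> \<le> t n" unfolding t_def by (rule pmf_tv_convolution_right_le)
    finally show ?thesis .
  qed
  have bound: "ennreal (pmf (mu0 G T \<mu> \<omega> k) x * (t n)\<^sup>2 / 4) \<le> entropy_gain k n \<omega>" for n
  proof -
    have "pmf_entropy (?\<nu> n) + ennreal (pmf (mu0 G T \<mu> \<omega> k) x * (t n)\<^sup>2 / 4)
        \<le> pmf_entropy (mu0 G T \<mu> \<omega> (n + Suc k))"
      using pmf_entropy_convolution[OF set_pmf_mu0[OF \<omega>] set_pmf_mu0[OF T_space[OF \<omega>]] x, of "Suc k" n]
      unfolding t_def mu0_add[OF \<omega>] .
    from ennreal_minus_mono[OF this order_refl, of "pmf_entropy (?\<nu> n)"] show ?thesis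
      unfolding entropy_gain_def using fin[of n] by (simp add: less_top del: funpow.simps)
  qed
  have "t \<longlonglongrightarrow> 0"
  proof (rule LIMSEQ_I)
    fix e :: real assume "0 < e"
    then have "(INF n. entropy_gain k n \<omega>) < ennreal (pmf (mu0 G T \<mu> \<omega> k) x * e\<^sup>2 / 4)"
      using gain x0 by simp
    then obtain n where "entropy_gain k n \<omega> < ennreal (pmf (mu0 G T \<mu> \<omega> k) x * e\<^sup>2 / 4)"
      by (auto simp: INF_less_iff)
    with bound[of n] have "ennreal (pmf (mu0 G T \<mu> \<omega> k) x * (t n)\<^sup>2 / 4)
        < ennreal (pmf (mu0 G T \<mu> \<omega> k) x * e\<^sup>2 / 4)" by (rule le_less_trans)
    then have "(t n)\<^sup>2 < e\<^sup>2" using x0 by (simp add: ennreal_less_iff)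
    then have "t n < e" using \<open>0 < e\<close> power_less_imp_less_base by (metis less_imp_le)
    moreover have "t m \<le> t n" if "n \<le> m" for m
      using lift_Suc_antimono_le[of t, OF anti that] .
    ultimately show "\<exists>n. \<forall>m\<ge>n. norm (t m - 0) < e"
      using t0 by (intro exI[of _ n]) (auto intro: le_less_trans)
  qed
  then show ?thesis unfolding t_def .
qed

text \<open>Nonsingularity gives two points \<open>h = g y\<close> and \<open>y\<close> charged at time \<open>k + 1\<close>; the futures from both are
  asymptotically equal to the law of the walk, and \<open>g\<close> carries the future from \<open>y\<close> to that from \<open>h\<close>.\<close>
lemma nonsingular_translate_vanishes:
  assumes \<omega>: "\<omega> \<in> space M" and g: "g \<in> carrier G"
    and sing: "\<not> mutually_singular (measure_pmf (mu0 G T \<mu> \<omega> k)) (measure_pmf (translate_pmf G g (mu0 G T \<mu> \<omega> k)))"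
    and gain: "(INF n. entropy_gain k n \<omega>) = 0"
    and fin: "\<And>n. pmf_entropy (mu0 G T \<mu> ((T ^^ Suc k) \<omega>) n) < \<infinity>"
  shows "(\<lambda>n. pmf_tv (translate_pmf G g (mu0 G T \<mu> \<omega> n)) (mu0 G T \<mu> \<omega> n)) \<longlonglongrightarrow> 0"
proof -
  obtain h y where h: "h \<in> set_pmf (mu0 G T \<mu> \<omega> k)" and y: "y \<in> set_pmf (mu0 G T \<mu> \<omega> k)" "h = g \<otimes> y"
    using not_mutually_singular_imp_common_point[OF sing] by (auto simp: set_pmf_translate)
  let ?\<nu> = "mu0 G T \<mu> ((T ^^ Suc k) \<omega>)"
  let ?q = "\<lambda>n. mu0 G T \<mu> \<omega> (n + Suc k)"
  let ?t = "\<lambda>x n. pmf_tv (translate_pmf G x (?\<nu> n)) (?q n)"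
  have "pmf_tv (translate_pmf G g (?q n)) (?q n) \<le> ?t y n + ?t h n" for n
  proof -
    have "y \<in> carrier G" using y set_pmf_mu0[OF \<omega>] by blast
    then have "translate_pmf G h (?\<nu> n) = translate_pmf G g (translate_pmf G y (?\<nu> n))"
      unfolding y(2) using g \<omega>
      by (intro translate_pmf_translate[symmetric] set_pmf_mu0 T_space)
    then have "pmf_tv (translate_pmf G g (?q n)) (translate_pmf G h (?\<nu> n)) \<le> ?t y n"
      using pmf_tv_translate_le[of G g "?q n" "translate_pmf G y (?\<nu> n)"]
      by (simp only: pmf_tv_commute[of "?q n"])
    then show ?thesis
      using pmf_tv_triangle[of "translate_pmf G g (?q n)" "?q n" "translate_pmf G h (?\<nu> n)"] by linarith
  qed
  moreover have "(\<lambda>n. ?t y n + ?t h n) \<longlonglongrightarrow> 0"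
    using tendsto_add[OF tv_translate_vanishes[OF \<omega> y(1) gain fin] tv_translate_vanishes[OF \<omega> h gain fin]]
    by simp
  ultimately have "(\<lambda>n. pmf_tv (translate_pmf G g (?q n)) (?q n)) \<longlonglongrightarrow> 0"
    by (rule pmf_tv_tendsto_0_dominated)
  then show ?thesis by (rule LIMSEQ_offset)
qed

end

context group
begin

text \<open>Left translations do not increase total variation, so the triangle inequality applies.\<close>
lemma asymptotic_stabilizer_subgroup:
  assumes supp: "\<And>n. set_pmf (\<theta> n) \<subseteq> carrier G"
  shows "subgroup {g \<in> carrier G. (\<lambda>n. pmf_tv (translate_pmf G g (\<theta> n)) (\<theta> n)) \<longlonglongrightarrow> 0} G"
    (is "subgroup ?L G")
proof (rule subgroupI)
  show "?L \<noteq> {}" using supp by (auto simp: translate_pmf_one intro!: exI[of _ \<one>])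
next
  fix g assume g: "g \<in> ?L"
  have "pmf_tv (translate_pmf G (inv g) (\<theta> n)) (\<theta> n) \<le> pmf_tv (translate_pmf G g (\<theta> n)) (\<theta> n)" for n
    using pmf_tv_translate_le[of G "inv g" "\<theta> n" "translate_pmf G g (\<theta> n)"] g supp
    by (simp add: translate_pmf_translate translate_pmf_one pmf_tv_commute)
  moreover have "(\<lambda>n. pmf_tv (translate_pmf G g (\<theta> n)) (\<theta> n)) \<longlonglongrightarrow> 0" using g by simp
  ultimately have "(\<lambda>n. pmf_tv (translate_pmf G (inv g) (\<theta> n)) (\<theta> n)) \<longlonglongrightarrow> 0"
    by (rule pmf_tv_tendsto_0_dominated)
  then show "inv g \<in> ?L" using g by simp
next
  fix g h assume g: "g \<in> ?L" and h: "h \<in> ?L"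
  have "pmf_tv (translate_pmf G (g \<otimes> h) (\<theta> n)) (\<theta> n)
      \<le> pmf_tv (translate_pmf G h (\<theta> n)) (\<theta> n) + pmf_tv (translate_pmf G g (\<theta> n)) (\<theta> n)" for n
    using pmf_tv_translate_le[of G g "translate_pmf G h (\<theta> n)" "\<theta> n"] g h supp
      pmf_tv_triangle[of "translate_pmf G (g \<otimes> h) (\<theta> n)" "\<theta> n" "translate_pmf G g (\<theta> n)"]
    by (simp add: translate_pmf_translate)
  moreover have "(\<lambda>n. pmf_tv (translate_pmf G h (\<theta> n)) (\<theta> n) + pmf_tv (translate_pmf G g (\<theta> n)) (\<theta> n)) \<longlonglongrightarrow> 0"
    using g h by (auto intro!: tendsto_add_zero)
  ultimately have "(\<lambda>n. pmf_tv (translate_pmf G (g \<otimes> h) (\<theta> n)) (\<theta> n)) \<longlonglongrightarrow> 0"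
    by (rule pmf_tv_tendsto_0_dominated)
  then show "g \<otimes> h \<in> ?L" using g h by simp
qed auto

end

theorem theorem4p5:
  fixes G :: "('g, 'b) monoid_scheme"
    and S :: "'g set"
    and M :: "'w measure"
    and T :: "'w \<Rightarrow> 'w"
    and \<mu> :: "'w \<Rightarrow> 'g pmf"
  assumes "nilpotent_group G"
    and "finite S" and "S \<subseteq> carrier G" and "generate G S = carrier G"
    and "rwrtp G M T \<mu>"
    and "rwrtp_irreducible G M T \<mu>"
    and "finite_first_moment G S M \<mu>"
  shows "(\<forall>g \<in> carrier G. AE \<omega> in M.
            (\<lambda>n. tv_norm (\<lambda>x. pmf (translate_pmf G g (mu0 G T \<mu> \<omega> n)) x
                                - pmf (mu0 G T \<mu> \<omega> n) x)) \<longlonglongrightarrow> 0) \<and>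
         (AE \<omega> in M. strongly_converges_to_left_invariance G (mu0 G T \<mu> \<omega>))"
proof -
  have "group G" using assms(1) by (simp add: nilpotent_group_def)
  then interpret group G .
  have rw: "lebesgue_prob_space M" "invertible_mpt M T"
    "\<forall>\<omega>\<in>space M. set_pmf (\<mu> \<omega>) \<subseteq> carrier G"
    "(\<lambda>\<omega>. measure_pmf (\<mu> \<omega>)) \<in> measurable M (prob_algebra (count_space UNIV))"
    using assms(5) unfolding rwrtp_def by blast+
  have \<mu>: "set_pmf (\<mu> \<omega>) \<subseteq> carrier G" if "\<omega> \<in> space M" for \<omega>
    using rw(3) that by blast
  have "T \<in> measurable M M" "distr M M T = M"
    using rw(2) unfolding invertible_mpt_def mod0_inverse_def by blast+
  moreover have "prob_space M"
    using rw(1) unfolding lebesgue_prob_space_def by blast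
  ultimately interpret random_walk_cocycle G M T \<mu>
    by (intro random_walk_cocycle.intro random_walk_cocycle_axioms.intro
        \<open>group G\<close> countable_carrier[OF assms(3,4,2)] \<mu> rw(4))
  let ?l = "word_length G S"
  have "mean_length ?l (\<mu> \<omega>)
      = (\<integral>\<^sup>+ g. ennreal (real (?l g) * pmf (\<mu> \<omega>) g) \<partial>count_space (carrier G))" if "\<omega> \<in> space M" for \<omega>
    by (simp add: mean_length_def nn_integral_measure_pmf_carrier[OF \<mu>[OF that]] ennreal_mult mult.commute)
  then have "(\<integral>\<^sup>+ \<omega>. mean_length ?l (\<mu> \<omega>) \<partial>M) < \<infinity>"
    using assms(7) unfolding finite_first_moment_def by (simp cong: nn_integral_cong)
  then have lin: "\<exists>Z. \<forall>n. mean_entropy n \<le> ennreal (\<epsilon> * real n + Z)" if "0 < \<epsilon>" for \<epsilon>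
    using that by (intro mean_entropy_sublinear[where l = ?l] word_length_mult_le[OF assms(3,4)]
        exp_word_length_summable[OF assms(3,4,2) nilpotent_polynomial_growth[OF assms(1-3)]]) auto
  have "AE \<omega> in M. \<forall>k. (INF n. entropy_gain k n \<omega>) = 0 \<and> (\<forall>n. pmf_entropy (mu0 G T \<mu> ((T ^^ Suc k) \<omega>) n) < \<infinity>)"
    unfolding AE_all_countable using AE_entropy_gain_vanishes[OF lin] by blast
  then have "AE \<omega> in M. \<forall>g\<in>carrier G. (\<lambda>n. pmf_tv (translate_pmf G g (mu0 G T \<mu> \<omega> n)) (mu0 G T \<mu> \<omega> n)) \<longlonglongrightarrow> 0"
    using assms(6)[unfolded rwrtp_irreducible_def] AE_space
  proof eventually_elim
    case (elim \<omega>)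
    let ?L = "{g \<in> carrier G. (\<lambda>n. pmf_tv (translate_pmf G g (mu0 G T \<mu> \<omega> n)) (mu0 G T \<mu> \<omega> n)) \<longlonglongrightarrow> 0}"
    let ?D = "{g \<in> carrier G. \<exists>n. \<not> mutually_singular (measure_pmf (mu0 G T \<mu> \<omega> n))
      (measure_pmf (translate_pmf G g (mu0 G T \<mu> \<omega> n)))}"
    have "generate G ?D \<subseteq> ?L"
    proof (rule generate_subgroup_incl)
      show "subgroup ?L G" by (rule asymptotic_stabilizer_subgroup) (rule set_pmf_mu0[OF elim(3)])
      show "?D \<subseteq> ?L"
      proof
        fix g assume "g \<in> ?D"
        then obtain k where g: "g \<in> carrier G" and k: "\<not> mutually_singular (measure_pmf (mu0 G T \<mu> \<omega> k))
            (measure_pmf (translate_pmf G g (mu0 G T \<mu> \<omega> k)))" by blast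
        have "(INF n. entropy_gain k n \<omega>) = 0" "\<And>n. pmf_entropy (mu0 G T \<mu> ((T ^^ Suc k) \<omega>) n) < \<infinity>"
          using elim(1) by blast+
        from nonsingular_translate_vanishes[OF elim(3) g k this] g show "g \<in> ?L" by blast
      qed
    qed
    moreover have "generate G ?D = carrier G"
      using elim(2) unfolding rwtdi_irreducible_def .
    ultimately show ?case by blast
  qed
  note conv = this[unfolded pmf_tv_def]
  show ?thesis
  proof (intro conjI ballI)
    show "AE \<omega> in M. strongly_converges_to_left_invariance G (mu0 G T \<mu> \<omega>)"
      using conv unfolding strongly_converges_to_left_invariance_def .
    show "AE \<omega> in M. (\<lambda>n. tv_norm (\<lambda>x. pmf (translate_pmf G g (mu0 G T \<mu> \<omega> n)) x
        - pmf (mu0 G T \<mu> \<omega> n) x)) \<longlonglongrightarrow> 0" if "g \<in> carrier G" for g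
      using conv by eventually_elim (use that in blast)
  qed
qed

end
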